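(* Let $f$ be a finite Blaschke product with $N>1$ zeros and with $f(0)=0$. Let $\{a_{n}\}_{n\ge1}$ be a sequence of complex numbers with $\sum_{n=1}^{\infty}|a_{n}|^{2}<\infty$ and $F=\sum_{n=1}^{\infty}a_{n}f^{n}$. Then $F \in \mathcal{D}$ if and only if $\sum^{\infty}_{n=1}|a_{n}|^{2}N^{n} < \infty$. Moreover there exists a constant $C=C(f)>0$, depending only on $f$ (not on the sequence $\{a_n\}$), such that $$ C^{-1}\sum^{\infty}_{n=1}|a_{n}|^{2}N^{n}\le \int_{\mathbb{D}}|F'(z)|^{2}\,dA(z)\le C\sum^{\infty}_{n=1}|a_{n}|^{2}N^{n}. $$
   Context: $\mathbb{D}$ is the open unit disc. Zeros of the finite Blaschke product are counted with multiplicity. $f^{n}$ denotes the $n$-th iterate of $f$ (not the power). When $\sum|a_n|^2<\infty$, the series $\sum a_nf^n$ converges in the Hardy space $\mathbb{H}^2(\mathbb{D})$ (hence uniformly on compact subsets of $\mathbb{D}$), and $F$ denotes its sum. $\mathcal{D}$ is the Dirichlet space of analytic functions $g$ in $\mathbb{D}$ with $\int_{\mathbb{D}}|g'(z)|^{2}\,dA(z)<\infty$, where $dA$ is area measure. *)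

theory Defs
  imports "HOL-Complex_Analysis.Complex_Analysis"
begin

text \<open>The zeros are listed with multiplicity as \<open>\<alpha> 0, \<dots>, \<alpha> (N - 1)\<close>. The function is only
  constrained on the open unit disc.\<close>

definition finite_blaschke_product :: "nat \<Rightarrow> (complex \<Rightarrow> complex) \<Rightarrow> bool" where
  "finite_blaschke_product N f \<longleftrightarrow>
     (\<exists>c \<alpha>. norm c = 1 \<and> (\<forall>k<N. norm (\<alpha> k) < 1) \<and>
        (\<forall>z\<in>ball 0 1. f z = c * (\<Prod>k<N. (z - \<alpha> k) / (1 - cnj (\<alpha> k) * z))))"

definition hardy2_norm_sq :: "(complex \<Rightarrow> complex) \<Rightarrow> ennreal" where
  "hardy2_norm_sq g =
     (SUP r\<in>{0<..<1::real}.
        \<integral>\<^sup>+t\<in>{0..2*pi}. ennreal ((norm (g (of_real r * cis t)))\<^sup>2 / (2 * pi)) \<partial>lborel)"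

definition hardy2 :: "(complex \<Rightarrow> complex) set" where
  "hardy2 = {g. g holomorphic_on ball 0 1 \<and> hardy2_norm_sq g < \<infinity>}"

definition hardy2_sums :: "(nat \<Rightarrow> complex \<Rightarrow> complex) \<Rightarrow> (complex \<Rightarrow> complex) \<Rightarrow> bool" where
  "hardy2_sums u F \<longleftrightarrow>
     (\<forall>n. u n \<in> hardy2) \<and> F \<in> hardy2 \<and>
     (\<lambda>m. hardy2_norm_sq (\<lambda>z. F z - (\<Sum>n<m. u n z))) \<longlonglongrightarrow> 0"

definition dirichlet_integral :: "(complex \<Rightarrow> complex) \<Rightarrow> ennreal" where
  "dirichlet_integral g = (\<integral>\<^sup>+z\<in>ball 0 1. ennreal ((norm (deriv g z))\<^sup>2) \<partial>lborel)"

definition dirichlet_space :: "(complex \<Rightarrow> complex) set" where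
  "dirichlet_space = {g. g holomorphic_on ball 0 1 \<and> dirichlet_integral g < \<infinity>}"

end

theory Submission
  imports Defs
begin

text \<open>The Dirichlet integral of \<open>g = \<Sum>k. c k * z ^ k\<close> is \<open>\<pi> * (\<Sum>k. k * |c k|\<^sup>2)\<close>, and a Blaschke product
  \<open>B\<close> of degree \<open>N\<close> satisfies \<open>D (h \<circ> B) = N * D h\<close>: on the unit circle \<open>cnj B = 1 / B\<close>, so the powers of
  \<open>B\<close> are pairwise orthogonal with \<open>D (B ^ j) = \<pi> * j * N\<close> by the argument principle.

  Put \<open>F\<^sub>j = (\<Sum>n. a (n + j) * f\<^sup>n)\<close>, so that \<open>F\<^sub>j = a j * z + F\<^sub>j\<^sub>+\<^sub>1 \<circ> f\<close>. Away from the linear coefficient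
  \<open>\<beta>\<^sub>j\<close> the functions \<open>F\<^sub>j\<close> and \<open>F\<^sub>j\<^sub>+\<^sub>1 \<circ> f\<close> agree, whence, with \<open>\<lambda> = f' 0\<close>,
  \<open>D F\<^sub>j + \<pi> * |\<lambda> * \<beta>\<^sub>j\<^sub>+\<^sub>1|\<^sup>2 = \<pi> * |\<beta>\<^sub>j|\<^sup>2 + N * D F\<^sub>j\<^sub>+\<^sub>1\<close> and \<open>\<beta>\<^sub>j = a j + \<lambda> * \<beta>\<^sub>j\<^sub>+\<^sub>1\<close>.
  Iterating this recursion gives both inequalities. The Hardy norm is treated in the same way, with
  Littlewood's inequality \<open>\<parallel>h \<circ> f\<parallel> \<le> \<parallel>h\<parallel>\<close> in place of the identity for \<open>D\<close> and \<open>|\<lambda>| < 1\<close> by Schwarz.\<close>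

subsection \<open>Parseval on circles and rotations of the plane\<close>

text \<open>The iterates are not orthogonal in the Dirichlet space: by polarising the composition
  identity, for \<open>m < n\<close> the pairing of the iterates of orders \<open>m\<close> and
  \<open>n\<close> is \<open>N^m\<close> times that of \<open>z\<close> with the iterate of order
  \<open>n - m\<close>, hence up to conjugation \<open>pi * N^m * \<lambda>^(n-m)\<close>. The
  coupling is felt only through the linear coefficient, which is why the recursion carries it along.
  On the Dirichlet side the factor \<open>N >= 2\<close> absorbs the cross terms using merely
  \<open>|\<lambda>| <= 1\<close>, so absolute constants come out; on the Hardy side no such factor
  exists, and the bound degenerates as \<open>|\<lambda>|\<close> tends to 1.

  The second obstacle is that integrals may be infinite and \<open>F\<close> may lack boundary
  values. Identities are therefore stated in extended nonnegative reals without subtraction. The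
  composition identity is bounded below by splitting off polynomials, whose remainder
  \<open>B^J * V\<close> is orthogonal to all lower powers for every holomorphic \<open>V\<close>,
  and above by Fatou's lemma along partial sums.\<close>

lemma cis_orthogonal:
  "((\<lambda>t. cis (real k * t) * cnj (cis (real l * t))) has_integral (if k = l then 2 * pi else 0)) {0..2*pi}"
proof (cases "k = l")
  case True
  have "((\<lambda>t. 1 :: complex) has_integral (2 * pi)) {0..2*pi}"
    using has_integral_const_real[of "1::complex" 0 "2*pi"] by (simp add: scaleR_conv_of_real)
  then show ?thesis using True by (simp add: cis_cnj cis_mult)
next
  case False
  define m where "m = real k - real l"
  have m: "m \<noteq> 0" using False by (simp add: m_def)
  have der: "((\<lambda>t. cis (m * t) / (\<i> * m)) has_vector_derivative cis (m * t)) (at t within {0..2*pi})" for t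
  proof -
    have "((\<lambda>z. exp (\<i> * m * z) / (\<i> * m)) has_field_derivative exp (\<i> * m * of_real t)) (at (of_real t))"
      using m by (auto intro!: derivative_eq_intros)
    from has_vector_derivative_real_field[OF this]
    show ?thesis by (simp add: cis_conv_exp mult.assoc)
  qed
  have "((\<lambda>t. cis (m * t)) has_integral (cis (m * (2*pi)) / (\<i> * m) - cis (m * 0) / (\<i> * m))) {0..2*pi}"
    by (rule fundamental_theorem_of_calculus) (auto intro: der)
  moreover have "cis (m * (2*pi)) = 1"
  proof -
    have "m = of_int (int k - int l)" by (simp add: m_def)
    then show ?thesis using cis_multiple_2pi[of m] by (metis Ints_of_int mult.commute mult.left_commute)
  qed
  moreover have "cis (real k * t) * cnj (cis (real l * t)) = cis (m * t)" for t
    by (simp add: cis_cnj cis_mult m_def algebra_simps)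
  ultimately show ?thesis using False by simp
qed

lemma summable_mult_cnj:
  fixes A B :: "nat \<Rightarrow> complex"
  assumes A: "summable (\<lambda>k. norm (A k))" and B: "summable (\<lambda>k. norm (B k))"
  shows "summable (\<lambda>k. A k * cnj (B k))"
proof -
  obtain K where K: "\<And>k. norm (B k) \<le> K"
    using summable_imp_bounded[OF B] by (auto simp: bounded_iff)
  show ?thesis
  proof (rule summable_norm_cancel, rule summable_comparison_test')
    show "summable (\<lambda>k. K * norm (A k))" using A by (rule summable_mult)
    show "norm (norm (A k * cnj (B k))) \<le> K * norm (A k)" if "k \<ge> 0" for k
      using mult_right_mono[OF K[of k], of "norm (A k)"] by (simp add: norm_mult mult.commute)
  qed
qed

lemma circle_parseval:
  fixes A B :: "nat \<Rightarrow> complex"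
  assumes A: "summable (\<lambda>k. norm (A k))" and B: "summable (\<lambda>k. norm (B k))"
  shows "((\<lambda>t. (\<Sum>k. A k * cis (real k * t)) * cnj (\<Sum>k. B k * cis (real k * t)))
           has_integral 2 * pi * (\<Sum>k. A k * cnj (B k))) {0..2*pi}"
proof -
  define P where "P n t = (\<Sum>k<n. A k * cis (real k * t))" for n t
  define Q where "Q n t = (\<Sum>k<n. B k * cis (real k * t))" for n t
  define p where "p t = (\<Sum>k. A k * cis (real k * t))" for t
  define q where "q t = (\<Sum>k. B k * cis (real k * t))" for t
  let ?I = "{0..2*pi}"
  have uP: "uniform_limit ?I P p sequentially"
    unfolding P_def p_def by (rule Weierstrass_m_test[OF _ A]) (simp add: norm_mult)
  have uQ: "uniform_limit ?I Q q sequentially"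
    unfolding Q_def q_def by (rule Weierstrass_m_test[OF _ B]) (simp add: norm_mult)
  \<comment> \<open>Boundedness of the two limits is what lets uniform convergence pass to the
    product.\<close>
  have bP: "bounded (p ` ?I)"
  proof (rule compact_imp_bounded, rule compact_continuous_image)
    show "continuous_on ?I p"
      by (rule uniform_limit_theorem[OF _ uP]) (auto simp: P_def cis_conv_exp intro!: always_eventually continuous_intros)
  qed auto
  have bQ: "bounded (q ` ?I)"
  proof (rule compact_imp_bounded, rule compact_continuous_image)
    show "continuous_on ?I q"
      by (rule uniform_limit_theorem[OF _ uQ]) (auto simp: Q_def cis_conv_exp intro!: always_eventually continuous_intros)
  qed auto
  have uQ': "uniform_limit ?I (\<lambda>n t. cnj (Q n t)) (\<lambda>t. cnj (q t)) sequentially"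
    using uQ by (simp add: uniform_limit_iff dist_norm flip: complex_cnj_diff)
  have bQ': "bounded ((\<lambda>t. cnj (q t)) ` ?I)"
    using bQ by (auto simp: bounded_iff)
  have u: "uniform_limit (cbox 0 (2*pi)) (\<lambda>n t. P n t * cnj (Q n t)) (\<lambda>t. p t * cnj (q t)) sequentially"
    using uniform_lim_mult[OF uP uQ' bP bQ'] by simp
  have int: "((\<lambda>t. P n t * cnj (Q n t)) has_integral (\<Sum>k<n. \<Sum>l<n. A k * cnj (B l) * (if k = l then 2 * pi else 0))) {0..2*pi}" for n
  proof -
    have "((\<lambda>t. \<Sum>k<n. \<Sum>l<n. A k * cnj (B l) * (cis (real k * t) * cnj (cis (real l * t))))
       has_integral (\<Sum>k<n. \<Sum>l<n. A k * cnj (B l) * (if k = l then 2 * pi else 0))) {0..2*pi}"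
      by (intro has_integral_sum has_integral_mult_right finite_lessThan) (use cis_orthogonal in simp)
    moreover have "P n t * cnj (Q n t) = (\<Sum>k<n. \<Sum>l<n. A k * cnj (B l) * (cis (real k * t) * cnj (cis (real l * t))))" for t
      unfolding P_def Q_def cnj_sum sum_product by (simp add: mult_ac)
    ultimately show ?thesis by simp
  qed
  have eq: "(\<Sum>k<n. \<Sum>l<n. A k * cnj (B l) * (if k = l then 2 * pi else 0)) = 2 * pi * (\<Sum>k<n. A k * cnj (B k))" for n
    by (simp add: sum_distrib_left if_distrib mult_ac cong: if_cong)
  have cont: "continuous_on (cbox 0 (2*pi)) (\<lambda>t. P n t * cnj (Q n t))" for n
    unfolding P_def Q_def cis_conv_exp by (intro continuous_intros)
  obtain I J where I: "\<And>n. ((\<lambda>t. P n t * cnj (Q n t)) has_integral I n) (cbox 0 (2*pi))"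
     and J: "((\<lambda>t. p t * cnj (q t)) has_integral J) (cbox 0 (2*pi))" and lim: "I \<longlonglongrightarrow> J"
    by (rule uniform_limit_integral_cbox[OF u cont trivial_limit_sequentially]) (rule that)
  have "I n = 2 * pi * (\<Sum>k<n. A k * cnj (B k))" for n
    using has_integral_unique[OF I[of n], of "2 * pi * (\<Sum>k<n. A k * cnj (B k))"] int[of n]
    unfolding eq interval_cbox[symmetric] by blast
  moreover have "summable (\<lambda>k. A k * cnj (B k))" by (rule summable_mult_cnj[OF A B])
  then have "(\<lambda>n. 2 * pi * (\<Sum>k<n. A k * cnj (B k))) \<longlonglongrightarrow> 2 * pi * (\<Sum>k. A k * cnj (B k))"
    by (intro tendsto_mult_left summable_LIMSEQ)
  ultimately have "I \<longlonglongrightarrow> 2 * pi * (\<Sum>k. A k * cnj (B k))" by presburger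
  with lim have "J = 2 * pi * (\<Sum>k. A k * cnj (B k))" by (rule LIMSEQ_unique)
  then show ?thesis using J by (simp add: p_def q_def)
qed

text \<open>The image of the product measure under \<open>(x, y) \<mapsto> x + i y\<close> agrees
  with \<open>lborel\<close> on boxes, and Tonelli does the rest. Both orders are recorded because a
  horizontal shear is treated with \<open>x\<close> innermost, a vertical one with \<open>y\<close>
  innermost.\<close>

lemma nn_integral_lborel_complex:
  fixes g :: "complex \<Rightarrow> ennreal"
  assumes [measurable]: "g \<in> borel_measurable borel"
  shows "(\<integral>\<^sup>+z. g z \<partial>lborel) = (\<integral>\<^sup>+y. \<integral>\<^sup>+x. g (Complex x y) \<partial>lborel \<partial>lborel)"
    and "(\<integral>\<^sup>+z. g z \<partial>lborel) = (\<integral>\<^sup>+x. \<integral>\<^sup>+y. g (Complex x y) \<partial>lborel \<partial>lborel)"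
proof -
  have meas: "(\<lambda>p. Complex (fst p) (snd p)) \<in> borel_measurable (lborel \<Otimes>\<^sub>M lborel)"
    unfolding Complex_eq by measurable
  have L: "lborel = distr (lborel \<Otimes>\<^sub>M lborel) borel (\<lambda>p. Complex (fst p) (snd p))" (is "_ = ?M")
  proof (rule lborel_eqI)
    fix l u :: complex
    assume le: "\<And>b. b \<in> Basis \<Longrightarrow> l \<bullet> b \<le> u \<bullet> b"
    have ri: "Re l \<le> Re u" "Im l \<le> Im u"
      using le[of 1] le[of \<i>] by (auto simp: Basis_complex_def inner_complex_def)
    have "(\<lambda>p. Complex (fst p) (snd p)) -` box l u = {Re l<..<Re u} \<times> {Im l<..<Im u}"
      by (auto simp: box_def Basis_complex_def inner_complex_def)
    then show "emeasure ?M (box l u) = (\<Prod>b\<in>Basis. (u - l) \<bullet> b)"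
      using ri by (simp add: emeasure_distr meas space_pair_measure lborel_pair.emeasure_pair_measure_Times
        lborel.emeasure_pair_measure_Times Basis_complex_def inner_complex_def ennreal_mult)
  qed simp
  have "(\<integral>\<^sup>+z. g z \<partial>lborel) = (\<integral>\<^sup>+p. g (Complex (fst p) (snd p)) \<partial>(lborel \<Otimes>\<^sub>M lborel))"
    by (subst L, subst nn_integral_distr) (auto simp: meas)
  moreover have m2: "(\<lambda>p. g (Complex (fst p) (snd p))) \<in> borel_measurable (lborel \<Otimes>\<^sub>M lborel)"
    using measurable_compose[OF meas assms] by simp
  ultimately show "(\<integral>\<^sup>+z. g z \<partial>lborel) = (\<integral>\<^sup>+y. \<integral>\<^sup>+x. g (Complex x y) \<partial>lborel \<partial>lborel)"
     "(\<integral>\<^sup>+z. g z \<partial>lborel) = (\<integral>\<^sup>+x. \<integral>\<^sup>+y. g (Complex x y) \<partial>lborel \<partial>lborel)"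
    using lborel_pair.nn_integral_snd[of "\<lambda>p. g (Complex (fst p) (snd p))"] lborel.nn_integral_fst[OF m2]
    by (simp_all add: case_prod_beta' m2)
qed

text \<open>With the other coordinate frozen, a shear is a translation of a line.\<close>

lemma nn_integral_lborel_shear:
  fixes g :: "complex \<Rightarrow> ennreal" and a :: real
  assumes [measurable]: "g \<in> borel_measurable borel"
  shows "(\<integral>\<^sup>+z. g (z + a * Im z) \<partial>lborel) = (\<integral>\<^sup>+z. g z \<partial>lborel)"
    and "(\<integral>\<^sup>+z. g (z + \<i> * a * Re z) \<partial>lborel) = (\<integral>\<^sup>+z. g z \<partial>lborel)"
proof -
  have c: "Complex x y = x + \<i> * y" for x y by (simp add: Complex_eq)
  have "(\<integral>\<^sup>+z. g (z + a * Im z) \<partial>lborel) = (\<integral>\<^sup>+y. \<integral>\<^sup>+x. g (Complex (a * y + 1 * x) y) \<partial>lborel \<partial>lborel)"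
    by (subst nn_integral_lborel_complex) (simp_all add: c algebra_simps)
  also have "\<dots> = (\<integral>\<^sup>+y. \<integral>\<^sup>+x. g (Complex x y) \<partial>lborel \<partial>lborel)"
  proof (rule nn_integral_cong)
    fix y
    have "(\<lambda>x. g (Complex x y)) \<in> borel_measurable borel" unfolding Complex_eq by measurable
    from nn_integral_real_affine[OF this, of 1 "a * y"]
    show "(\<integral>\<^sup>+x. g (Complex (a * y + 1 * x) y) \<partial>lborel) = (\<integral>\<^sup>+x. g (Complex x y) \<partial>lborel)" by simp
  qed
  also have "\<dots> = (\<integral>\<^sup>+z. g z \<partial>lborel)" by (rule nn_integral_lborel_complex(1)[symmetric]) fact
  finally show "(\<integral>\<^sup>+z. g (z + a * Im z) \<partial>lborel) = (\<integral>\<^sup>+z. g z \<partial>lborel)" .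
  have "(\<integral>\<^sup>+z. g (z + \<i> * a * Re z) \<partial>lborel) = (\<integral>\<^sup>+x. \<integral>\<^sup>+y. g (Complex x (a * x + 1 * y)) \<partial>lborel \<partial>lborel)"
    by (subst nn_integral_lborel_complex(2)) (simp_all add: c algebra_simps)
  also have "\<dots> = (\<integral>\<^sup>+x. \<integral>\<^sup>+y. g (Complex x y) \<partial>lborel \<partial>lborel)"
  proof (rule nn_integral_cong)
    fix x
    have "(\<lambda>y. g (Complex x y)) \<in> borel_measurable borel" unfolding Complex_eq by measurable
    from nn_integral_real_affine[OF this, of 1 "a * x"]
    show "(\<integral>\<^sup>+y. g (Complex x (a * x + 1 * y)) \<partial>lborel) = (\<integral>\<^sup>+y. g (Complex x y) \<partial>lborel)" by simp
  qed
  also have "\<dots> = (\<integral>\<^sup>+z. g z \<partial>lborel)" by (rule nn_integral_lborel_complex(2)[symmetric]) fact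
  finally show "(\<integral>\<^sup>+z. g (z + \<i> * a * Re z) \<partial>lborel) = (\<integral>\<^sup>+z. g z \<partial>lborel)" .
qed

text \<open>A rotation by an angle other than \<open>\<pi>\<close> is a product of three shears.\<close>

lemma nn_integral_lborel_rotate:
  fixes g :: "complex \<Rightarrow> ennreal"
  assumes meas: "g \<in> borel_measurable borel"
  shows "(\<integral>\<^sup>+z. g (cis t * z) \<partial>lborel) = (\<integral>\<^sup>+z. g z \<partial>lborel)"
proof -
  have *: "(\<integral>\<^sup>+z. h (cis t * z) \<partial>lborel) = (\<integral>\<^sup>+z. h z \<partial>lborel)"
    if cos: "cos t \<noteq> -1" and [measurable]: "h \<in> borel_measurable borel" for t and h :: "complex \<Rightarrow> ennreal"
  proof -
    \<comment> \<open>This is \<open>- tan (t / 2)\<close>, found by comparing the entries of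
      \<open>X \<circ> Y \<circ> X\<close> with those of the rotation matrix; it is singular exactly
      at the half turn.\<close>
    define s where "s = - sin t / (1 + cos t)"
    define X where "X z = z + complex_of_real s * Im z" for z
    define Y where "Y z = z + \<i> * complex_of_real (sin t) * Re z" for z
    have ne: "1 + cos t \<noteq> 0" using cos by linarith
    have s1: "1 + sin t * s = cos t"
    proof -
      have "(1 + cos t) * (1 - cos t) = sin t ^ 2"
        using sin_cos_squared_add[of t] by (simp add: algebra_simps power2_eq_square)
      then show ?thesis using ne by (simp add: s_def field_simps power2_eq_square)
    qed
    have s2: "s + s * cos t = - sin t"
    proof -
      have "s + s * cos t = s * (1 + cos t)" by (simp add: algebra_simps)
      then show ?thesis using ne by (simp add: s_def)
    qed
    have "X (Y (X z)) = cis t * z" for z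
    proof (rule complex_eqI)
      have "Re (X (Y (X z))) = (1 + sin t * s) * Re z + (s + s * (1 + sin t * s)) * Im z"
        by (simp add: X_def Y_def algebra_simps)
      then show "Re (X (Y (X z))) = Re (cis t * z)" by (simp add: s1 s2)
      have "Im (X (Y (X z))) = sin t * Re z + (1 + sin t * s) * Im z"
        by (simp add: X_def Y_def algebra_simps)
      then show "Im (X (Y (X z))) = Im (cis t * z)" by (simp add: s1)
    qed
    then have "(\<integral>\<^sup>+z. h (cis t * z) \<partial>lborel) = (\<integral>\<^sup>+z. h (X (Y (X z))) \<partial>lborel)" by simp
    also have "\<dots> = (\<integral>\<^sup>+z. h (X (Y z)) \<partial>lborel)"
      using nn_integral_lborel_shear(1)[of "\<lambda>w. h (X (Y w))" s] by (simp add: X_def Y_def)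
    also have "\<dots> = (\<integral>\<^sup>+z. h (X z) \<partial>lborel)"
      using nn_integral_lborel_shear(2)[of "\<lambda>w. h (X w)" "sin t"] by (simp add: X_def Y_def)
    also have "\<dots> = (\<integral>\<^sup>+z. h z \<partial>lborel)"
      using nn_integral_lborel_shear(1)[of h s] by (simp add: X_def)
    finally show ?thesis .
  qed
  show ?thesis
  proof (cases "cos t = -1")
    case False
    then show ?thesis using * meas by blast
  next
    case True
    then have "sin t = 0" using sin_cos_squared_add[of t] by simp
    \<comment> \<open>The half turn is performed as two quarter turns, to which the shear
      factorisation applies.\<close>
    with True have t: "cis t = cis (pi/2) * cis (pi/2)" by (simp add: complex_eq_iff)
    have m: "(\<lambda>z. g (cis (pi/2) * z)) \<in> borel_measurable borel"
      using meas by measurable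
    show ?thesis
      unfolding t using *[OF _ m, of "pi/2"] *[OF _ meas, of "pi/2"] by (simp add: mult.assoc)
  qed
qed

text \<open>Layer-cake argument: for \<open>k > 0\<close>, \<open>|z|^(2k)\<close> is the integral
  of \<open>2k * s^(2k-1)\<close> over \<open>0 <= s <= |z|\<close>; after exchanging the integrals
  the inner one is the area \<open>pi - pi * s^2\<close> of an annulus. For \<open>k = 0\<close> the
  weight vanishes while the integrand is 1, so the area of the disc is taken directly.\<close>

lemma nn_integral_ball_norm_power:
  "(\<integral>\<^sup>+z\<in>ball (0::complex) 1. ennreal (norm z ^ (2 * k)) \<partial>lborel) = ennreal (pi / (k + 1))"
proof (cases "k = 0")
  case True
  then show ?thesis by (simp add: emeasure_ball unit_ball_vol_2)
next
  case False
  let ?w = "\<lambda>s::real. 2 * k * s ^ (2 * k - 1)"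
  let ?B = "ball (0::complex) 1"
  have area: "emeasure lborel (ball (0::complex) r) = ennreal (pi * r\<^sup>2)" if "r \<ge> 0" for r
    using that by (simp add: emeasure_ball unit_ball_vol_2)
  have inner: "ennreal (norm z ^ (2 * k)) = (\<integral>\<^sup>+s. ennreal (?w s) * indicator {0..norm z} s \<partial>lborel)" for z :: complex
  proof -
    have "(\<integral>\<^sup>+s. ennreal (?w s) * indicator {0..norm z} s \<partial>lborel) = norm z ^ (2 * k) - 0 ^ (2 * k)"
      by (rule nn_integral_FTC_Icc) (auto intro!: derivative_eq_intros)
    then show ?thesis using False by simp
  qed
  have "(\<integral>\<^sup>+z\<in>?B. ennreal (norm z ^ (2 * k)) \<partial>lborel)
      = (\<integral>\<^sup>+z. \<integral>\<^sup>+s. ennreal (?w s) * indicator {0..norm z} s * indicator ?B z \<partial>lborel \<partial>lborel)"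
    by (simp add: inner nn_integral_multc)
  also have "\<dots> = (\<integral>\<^sup>+s. \<integral>\<^sup>+z. ennreal (?w s) * indicator {0..norm z} s * indicator ?B z \<partial>lborel \<partial>lborel)"
  proof (rule lborel_pair.Fubini')
    have "{p \<in> space (borel \<Otimes>\<^sub>M borel). 0 \<le> fst p \<and> fst p \<le> norm (snd p) \<and> norm (snd p) < 1}
        \<in> sets (borel \<Otimes>\<^sub>M (borel :: complex measure))"
      by measurable
    then have [measurable]: "{p. 0 \<le> fst p \<and> fst p \<le> norm (snd p) \<and> norm (snd p) < 1}
        \<in> sets (borel \<Otimes>\<^sub>M (borel :: complex measure))"
      by (simp add: space_pair_measure)
    have "(\<lambda>p. ennreal (?w (fst p)) * indicator {p. 0 \<le> fst p \<and> fst p \<le> norm (snd p) \<and> norm (snd p) < 1} p)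
        \<in> borel_measurable (borel \<Otimes>\<^sub>M (borel :: complex measure))"
      by measurable
    also have "(\<lambda>p. ennreal (?w (fst p)) * indicator {p. 0 \<le> fst p \<and> fst p \<le> norm (snd p) \<and> norm (snd p) < 1} p)
        = (\<lambda>(s, z). ennreal (?w s) * indicator {0..norm z} s * indicator ?B z)"
      by (auto simp: fun_eq_iff indicator_def)
    finally show "(\<lambda>(s, z). ennreal (?w s) * indicator {0..norm z} s * indicator ?B z)
        \<in> borel_measurable (lborel \<Otimes>\<^sub>M lborel)"
      by (simp cong: measurable_cong_sets)
  qed
  also have "\<dots> = (\<integral>\<^sup>+s. ennreal (?w s * (pi - pi * s\<^sup>2)) * indicator {0..1} s \<partial>lborel)"
  proof (rule nn_integral_cong)
    fix s :: real
    show "(\<integral>\<^sup>+z. ennreal (?w s) * indicator {0..norm z} s * indicator ?B z \<partial>lborel)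
        = ennreal (?w s * (pi - pi * s\<^sup>2)) * indicator {0..1} s"
    proof (cases "0 \<le> s \<and> s \<le> 1")
      case True
      then have "(\<integral>\<^sup>+z. ennreal (?w s) * indicator {0..norm z} s * indicator ?B z \<partial>lborel)
          = (\<integral>\<^sup>+z. ennreal (?w s) * indicator (?B - ball 0 s) z \<partial>lborel)"
        by (intro nn_integral_cong) (auto simp: indicator_def)
      also have "\<dots> = ennreal (?w s) * emeasure lborel (?B - ball 0 s)"
        by (rule nn_integral_cmult_indicator) simp
      also have "emeasure lborel (?B - ball 0 s) = ennreal (pi - pi * s\<^sup>2)"
        using True by (subst emeasure_Diff) (auto simp: area ennreal_minus)
      finally show ?thesis using True by (simp add: ennreal_mult')
    next
      case False
      then have z: "indicator {0..norm z} s * indicator ?B z = (0::ennreal)" for z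
        by (auto simp: indicator_def)
      then show ?thesis using False unfolding mult.assoc z by auto
    qed
  qed
  also have "\<dots> = ennreal (2 * k * pi * (1 / (2 * k) - 1 / (2 * k + 2)) - 0)"
  proof -
    let ?F = "\<lambda>s::real. 2 * k * pi * (s ^ (2 * k) / (2 * k) - s ^ (2 * k + 2) / (2 * k + 2))"
    have "(?F has_real_derivative ?w s * (pi - pi * s\<^sup>2)) (at s)" for s
    proof -
      have e: "s ^ (2 * k + 1) = s ^ (2 * k - 1) * s\<^sup>2"
        using False by (simp flip: power_add)
      have "((\<lambda>s. s ^ (2 * k) / (2 * k) - s ^ (2 * k + 2) / (2 * k + 2)) has_real_derivative
          s ^ (2 * k - 1) - s ^ (2 * k + 1)) (at s)"
        using DERIV_diff[OF DERIV_cdivide[OF DERIV_pow[of "2 * k" s], of "real (2 * k)"]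
            DERIV_cdivide[OF DERIV_pow[of "2 * k + 2" s], of "real (2 * k + 2)"]] False
        by (simp add: eval_nat_numeral)
      then have "(?F has_real_derivative 2 * k * pi * (s ^ (2 * k - 1) - s ^ (2 * k + 1))) (at s)"
        by (rule DERIV_cmult)
      then show ?thesis
        unfolding e by (simp add: algebra_simps)
    qed
    moreover have "0 \<le> ?w s * (pi - pi * s\<^sup>2)" if "0 \<le> s" "s \<le> 1" for s
      using that by (simp add: power_le_one)
    ultimately have "(\<integral>\<^sup>+s. ennreal (?w s * (pi - pi * s\<^sup>2)) * indicator {0..1} s \<partial>lborel) = ?F 1 - ?F 0"
      by (intro nn_integral_FTC_Icc) auto
    then show ?thesis using False by (simp add: power_0_left)
  qed
  also have "2 * k * pi * (1 / (2 * k) - 1 / (2 * k + 2)) - 0 = pi / (k + 1)"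
    using False by (auto simp: divide_simps)
  finally show ?thesis .
qed

subsection \<open>Hardy and Dirichlet norms in terms of Taylor coefficients\<close>

text \<open>Expansions are kept as a relation rather than through derivatives at 0, so that the
  coefficients of sums, shifts and derivatives can be written down directly. Values outside the open
  disc stay unconstrained.\<close>

definition disc_series :: "(nat \<Rightarrow> complex) \<Rightarrow> (complex \<Rightarrow> complex) \<Rightarrow> bool" where
  "disc_series c g \<longleftrightarrow> (\<forall>z\<in>ball 0 1. (\<lambda>k. c k * z ^ k) sums g z)"

lemma disc_seriesD: "disc_series c g \<Longrightarrow> norm z < 1 \<Longrightarrow> (\<lambda>k. c k * z ^ k) sums g z"
  by (simp add: disc_series_def)

lemma summable_norm_power_series:
  fixes c :: "nat \<Rightarrow> complex"
  assumes c: "disc_series c g" and z: "norm z < 1"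
  shows "summable (\<lambda>k. norm (c k * z ^ k))"
proof -
  obtain r where r: "norm z < r" "r < 1" using z dense by blast
  then have "0 < r" by (meson norm_ge_zero order_le_less_trans)
  then have "norm (complex_of_real r) < 1" using r by simp
  from sums_summable[OF disc_seriesD[OF c this]] show ?thesis
    by (rule powser_insidea) (use r \<open>0 < r\<close> in simp)
qed

text \<open>Parseval with \<open>c k * z ^ k\<close> in both slots. The circle starts at an
  arbitrary \<open>z\<close>: positive \<open>z\<close> gives the Hardy means, while general
  \<open>z\<close> arises when the Dirichlet integrand is averaged over rotations.\<close>

lemma circle_mean_square:
  fixes c :: "nat \<Rightarrow> complex"
  assumes c: "disc_series c g" and z: "norm z < 1"
  shows "(\<integral>\<^sup>+t\<in>{0..2*pi}. ennreal ((norm (g (z * cis t)))\<^sup>2 / (2 * pi)) \<partial>lborel)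
           = (\<Sum>k. ennreal ((norm (c k))\<^sup>2 * norm z ^ (2 * k)))"
proof -
  define A where "A k = c k * z ^ k" for k
  have A: "summable (\<lambda>k. norm (A k))"
    unfolding A_def by (rule summable_norm_power_series[OF c z])
  have g: "g (z * cis t) = (\<Sum>k. A k * cis (real k * t))" for t
  proof -
    have "norm (z * cis t) < 1" using z by (simp add: norm_mult)
    then have "(\<lambda>k. c k * (z * cis t) ^ k) sums g (z * cis t)" by (rule disc_seriesD[OF c])
    then show ?thesis
      by (simp add: A_def power_mult_distrib Complex.DeMoivre sums_iff mult.assoc)
  qed
  have A2: "summable (\<lambda>k. (norm (A k))\<^sup>2)"
  proof (rule summable_comparison_test_ev)
    have "(\<lambda>k. norm (A k)) \<longlonglongrightarrow> 0" using A by (rule summable_LIMSEQ_zero)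
    then have "\<forall>\<^sub>F k in sequentially. norm (A k) < 1"
      by (rule order_tendstoD) simp
    then show "\<forall>\<^sub>F k in sequentially. norm ((norm (A k))\<^sup>2) \<le> norm (A k)"
      by eventually_elim (simp add: power2_eq_square mult_left_le)
  qed fact
  have "((\<lambda>t. g (z * cis t) * cnj (g (z * cis t))) has_integral 2 * pi * (\<Sum>k. A k * cnj (A k))) {0..2*pi}"
    unfolding g by (rule circle_parseval[OF A A])
  moreover have "(\<Sum>k. A k * cnj (A k)) = of_real (\<Sum>k. (norm (A k))\<^sup>2)"
    unfolding complex_norm_square[symmetric] by (rule suminf_of_real[OF A2, symmetric])
  ultimately have "((\<lambda>t. complex_of_real ((norm (g (z * cis t)))\<^sup>2)) has_integral of_real (2 * pi * (\<Sum>k. (norm (A k))\<^sup>2))) {0..2*pi}"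
    unfolding complex_norm_square[symmetric] by simp
  from has_integral_Re[OF this]
  have "((\<lambda>t. (norm (g (z * cis t)))\<^sup>2) has_integral 2 * pi * (\<Sum>k. (norm (A k))\<^sup>2)) {0..2*pi}"
    unfolding Re_complex_of_real .
  from has_integral_divide[OF this, of "2 * pi"]
  have I: "((\<lambda>t. (norm (g (z * cis t)))\<^sup>2 / (2 * pi)) has_integral (\<Sum>k. (norm (A k))\<^sup>2)) {0..2*pi}"
    by simp
  have "(\<integral>\<^sup>+t\<in>{0..2*pi}. ennreal ((norm (g (z * cis t)))\<^sup>2 / (2 * pi)) \<partial>lborel)
      = ennreal (\<Sum>k. (norm (A k))\<^sup>2)"
    by (rule nn_integral_has_integral_lebesgue'[OF _ I]) auto
  also have "\<dots> = (\<Sum>k. ennreal ((norm (A k))\<^sup>2))"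
    by (rule suminf_ennreal2[symmetric]) (use A2 in auto)
  finally show ?thesis
    by (simp add: A_def norm_mult norm_power power_mult_distrib power_even_eq)
qed

lemma hardy2_norm_sq_coeffs:
  fixes c :: "nat \<Rightarrow> complex"
  assumes c: "disc_series c g"
  shows "hardy2_norm_sq g = (\<Sum>k. ennreal ((norm (c k))\<^sup>2))"
proof -
  define S where "S r = (\<Sum>k. ennreal ((norm (c k))\<^sup>2 * r ^ (2 * k)))" for r :: real
  have H: "hardy2_norm_sq g = (SUP r\<in>{0<..<1}. S r)"
    unfolding hardy2_norm_sq_def
  proof (rule SUP_cong)
    fix r :: real assume "r \<in> {0<..<1}"
    then have r: "norm (complex_of_real r) = r" "r < 1" by auto
    show "(\<integral>\<^sup>+t\<in>{0..2*pi}. ennreal ((norm (g (of_real r * cis t)))\<^sup>2 / (2 * pi)) \<partial>lborel) = S r"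
      using circle_mean_square[OF c, of "of_real r", unfolded r(1), OF r(2)] unfolding S_def .
  qed simp
  show ?thesis
  proof (rule antisym)
    show "hardy2_norm_sq g \<le> (\<Sum>k. ennreal ((norm (c k))\<^sup>2))"
      unfolding H S_def
      by (intro SUP_least suminf_le ennreal_leI) (auto intro!: mult_left_le power_le_one)
    show "(\<Sum>k. ennreal ((norm (c k))\<^sup>2)) \<le> hardy2_norm_sq g"
    proof (rule suminf_le_const)
      fix K
      \<comment> \<open>\<open>K\<close> is fixed before \<open>r\<close> tends to 1, so only a
        finite sum passes to the limit and the full series may diverge.\<close>
      have "((\<lambda>r. ennreal (\<Sum>k<K. (norm (c k))\<^sup>2 * r ^ (2 * k))) \<longlongrightarrow> ennreal (\<Sum>k<K. (norm (c k))\<^sup>2 * 1 ^ (2 * k))) (at_left (1::real))"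
        by (intro tendsto_intros)
      moreover have "\<forall>\<^sub>F r in at_left (1::real). ennreal (\<Sum>k<K. (norm (c k))\<^sup>2 * r ^ (2 * k)) \<le> hardy2_norm_sq g"
        using eventually_at_left_real[of 0 1, simplified]
      proof eventually_elim
        case (elim r)
        have "ennreal (\<Sum>k<K. (norm (c k))\<^sup>2 * r ^ (2 * k)) = (\<Sum>k<K. ennreal ((norm (c k))\<^sup>2 * r ^ (2 * k)))"
          by (rule sum_ennreal[symmetric]) (use elim in auto)
        also have "\<dots> \<le> S r" unfolding S_def by (intro sum_le_suminf) auto
        also have "\<dots> \<le> hardy2_norm_sq g" unfolding H using elim by (intro SUP_upper) auto
        finally show ?case .
      qed
      ultimately have "ennreal (\<Sum>k<K. (norm (c k))\<^sup>2 * 1 ^ (2 * k)) \<le> hardy2_norm_sq g"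
        by (intro tendsto_upperbound) auto
      then show "(\<Sum>k<K. ennreal ((norm (c k))\<^sup>2)) \<le> hardy2_norm_sq g"
        by (simp add: sum_ennreal)
    qed auto
  qed
qed

lemma disc_series_deriv:
  assumes c: "disc_series c g"
  shows "disc_series (\<lambda>k. of_nat (Suc k) * c (Suc k)) (deriv g)"
  unfolding disc_series_def
proof
  fix z :: complex assume z: "z \<in> ball 0 1"
  then have z1: "norm z < 1" by simp
  obtain r where r: "norm z < r" "r < 1" using z1 dense by blast
  then have r0: "0 < r" by (meson norm_ge_zero order_le_less_trans)
  then have "norm (complex_of_real r) < 1" using r by simp
  note s = sums_summable[OF disc_seriesD[OF c this]]
  have "((\<lambda>z. \<Sum>k. c k * z ^ k) has_field_derivative (\<Sum>k. diffs c k * z ^ k)) (at z)"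
    by (rule termdiffs_strong[OF s]) (use r r0 in simp)
  then have "(g has_field_derivative (\<Sum>k. diffs c k * z ^ k)) (at z)"
    by (rule has_field_derivative_transform_within_open[OF _ open_ball z]) (use c in \<open>auto simp: sums_iff disc_series_def\<close>)
  then have "deriv g z = (\<Sum>k. diffs c k * z ^ k)" by (rule DERIV_imp_deriv)
  moreover have "summable (\<lambda>k. diffs c k * z ^ k)"
    by (rule termdiff_converges[OF z1]) (use c in \<open>auto simp: sums_iff disc_series_def\<close>)
  ultimately show "(\<lambda>k. of_nat (Suc k) * c (Suc k) * z ^ k) sums deriv g z" by (simp add: sums_iff diffs_def)
qed

lemma disc_series_holomorphic: "disc_series c g \<Longrightarrow> g holomorphic_on ball 0 1"
  by (rule power_series_holomorphic[where a = c]) (simp add: disc_series_def)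

lemma borel_measurable_deriv_on_disc:
  assumes hol: "g holomorphic_on ball 0 1"
  shows "(\<lambda>z. ennreal ((norm (deriv g z))\<^sup>2) * indicator (ball 0 1) z) \<in> borel_measurable borel"
proof -
  let ?B = "ball (0::complex) 1"
  have "continuous_on ?B (\<lambda>z. (norm (deriv g z))\<^sup>2)"
    by (intro continuous_intros holomorphic_on_imp_continuous_on holomorphic_deriv hol) auto
  then have "(\<lambda>z. indicator ?B z *\<^sub>R (norm (deriv g z))\<^sup>2) \<in> borel_measurable borel"
    by (intro borel_measurable_continuous_on_indicator) auto
  then have "(\<lambda>z. ennreal (indicator ?B z *\<^sub>R (norm (deriv g z))\<^sup>2)) \<in> borel_measurable borel"
    by measurable
  also have "(\<lambda>z. ennreal (indicator ?B z *\<^sub>R (norm (deriv g z))\<^sup>2)) = (\<lambda>z. ennreal ((norm (deriv g z))\<^sup>2) * indicator ?B z)"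
    by (auto simp: indicator_def)
  finally show ?thesis .
qed

text \<open>Rotation invariance of area allows averaging the integrand over all rotations. After
  Tonelli the inner average is the circular mean square of \<open>deriv g\<close>, and integrating
  \<open>|z|^(2k)\<close> over the disc turns \<open>(k+1)^2 * |c (k+1)|^2\<close> into
  \<open>pi * (k+1) * |c (k+1)|^2\<close>. All terms are nonnegative, so infinite values are
  covered.\<close>

lemma dirichlet_integral_coeffs:
  fixes c :: "nat \<Rightarrow> complex"
  assumes c: "disc_series c g"
  shows "dirichlet_integral g = (\<Sum>k. ennreal (pi * k * (norm (c k))\<^sup>2))"
proof -
  let ?B = "ball (0::complex) 1"
  define d where "d k = of_nat (Suc k) * c (Suc k)" for k
  have d: "disc_series d (deriv g)"
    using disc_series_deriv[OF c] unfolding d_def .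
  have h[measurable]: "(\<lambda>z. ennreal ((norm (deriv g z))\<^sup>2) * indicator ?B z) \<in> borel_measurable borel" (is "?h \<in> _")
    by (rule borel_measurable_deriv_on_disc[OF disc_series_holomorphic[OF c]])
  have [measurable]: "cis \<in> borel_measurable borel"
    by (intro borel_measurable_continuous_onI) (auto simp: cis_conv_exp intro!: continuous_intros)
  have m: "(\<lambda>z::complex. ennreal (norm z ^ (2 * k)) * indicator ?B z) \<in> borel_measurable lborel" for k
    by (intro borel_measurable_times_ennreal borel_measurable_indicator) auto
  have "dirichlet_integral g = ennreal (1 / (2 * pi)) * (\<integral>\<^sup>+t. dirichlet_integral g * indicator {0..2*pi} t \<partial>lborel)"
    by (simp add: nn_integral_cmult_indicator mult.left_commute flip: ennreal_mult)
  also have "\<dots> = (\<integral>\<^sup>+t. \<integral>\<^sup>+z. ennreal (1 / (2 * pi)) * (indicator {0..2*pi} t * ?h (cis t * z)) \<partial>lborel \<partial>lborel)"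
  proof -
    have "dirichlet_integral g * indicator {0..2*pi} t = (\<integral>\<^sup>+z. indicator {0..2*pi} t * ?h (cis t * z) \<partial>lborel)" for t
    proof -
      have "dirichlet_integral g = (\<integral>\<^sup>+z. ?h (cis t * z) \<partial>lborel)"
        unfolding dirichlet_integral_def by (rule nn_integral_lborel_rotate[OF h, symmetric])
      moreover have "(\<lambda>z. ?h (cis t * z)) \<in> borel_measurable lborel"
        using measurable_compose[OF _ h, of "\<lambda>z. cis t * z" lborel] by simp
      ultimately show ?thesis by (simp only: nn_integral_cmult mult.commute)
    qed
    then show ?thesis
      by (subst nn_integral_cmult[symmetric]) (auto simp: nn_integral_cmult)
  qed
  also have "\<dots> = (\<integral>\<^sup>+z. \<integral>\<^sup>+t. ennreal (1 / (2 * pi)) * (indicator {0..2*pi} t * ?h (cis t * z)) \<partial>lborel \<partial>lborel)"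
  proof (rule lborel_pair.Fubini')
    have "(\<lambda>p. cis (snd p) * fst p) \<in> (borel \<Otimes>\<^sub>M borel) \<rightarrow>\<^sub>M borel" by measurable
    from measurable_compose[OF this h]
    show "(\<lambda>(z, t). ennreal (1 / (2 * pi)) * (indicator {0..2*pi} t * ?h (cis t * z))) \<in> borel_measurable (lborel \<Otimes>\<^sub>M lborel)"
      by (simp add: case_prod_beta' cong: measurable_cong_sets)
  qed
  also have "\<dots> = (\<integral>\<^sup>+z. (\<Sum>k. ennreal ((norm (d k))\<^sup>2 * norm z ^ (2 * k))) * indicator ?B z \<partial>lborel)"
  proof (rule nn_integral_cong)
    fix z :: complex
    show "(\<integral>\<^sup>+t. ennreal (1 / (2 * pi)) * (indicator {0..2*pi} t * ?h (cis t * z)) \<partial>lborel)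
        = (\<Sum>k. ennreal ((norm (d k))\<^sup>2 * norm z ^ (2 * k))) * indicator ?B z"
    proof (cases "norm z < 1")
      case True
      have "(\<integral>\<^sup>+t. ennreal (1 / (2 * pi)) * (indicator {0..2*pi} t * ?h (cis t * z)) \<partial>lborel)
         = (\<integral>\<^sup>+t\<in>{0..2*pi}. ennreal ((norm (deriv g (z * cis t)))\<^sup>2 / (2 * pi)) \<partial>lborel)"
      proof (rule nn_integral_cong)
        fix t
        have *: "cis t * z = z * cis t" "norm (z * cis t) < 1" using True by (simp_all add: norm_mult)
        show "ennreal (1 / (2 * pi)) * (indicator {0..2*pi} t * ?h (cis t * z))
            = ennreal ((norm (deriv g (z * cis t)))\<^sup>2 / (2 * pi)) * indicator {0..2*pi} t"
          unfolding *(1) using *(2) by (auto simp: indicator_def simp flip: ennreal_mult')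
      qed
      also have "\<dots> = (\<Sum>k. ennreal ((norm (d k))\<^sup>2 * norm z ^ (2 * k)))"
        by (rule circle_mean_square[OF d True])
      finally show ?thesis using True by simp
    next
      case False
      then show ?thesis by (simp add: norm_mult)
    qed
  qed
  also have "\<dots> = (\<Sum>k. \<integral>\<^sup>+z. ennreal ((norm (d k))\<^sup>2) * (ennreal (norm z ^ (2 * k)) * indicator ?B z) \<partial>lborel)"
  proof -
    have "(\<Sum>k. ennreal ((norm (d k))\<^sup>2 * norm z ^ (2 * k))) * indicator ?B z
        = (\<Sum>k. ennreal ((norm (d k))\<^sup>2) * (ennreal (norm z ^ (2 * k)) * indicator ?B z))" for z
      by (simp add: ennreal_mult mult.assoc flip: ennreal_suminf_multc)
    then show ?thesis by (simp only:) (rule nn_integral_suminf, intro borel_measurable_times_ennreal m, simp)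
  qed
  also have "\<dots> = (\<Sum>k. ennreal ((norm (d k))\<^sup>2) * ennreal (pi / (k + 1)))"
    by (simp only: nn_integral_cmult[OF m] nn_integral_ball_norm_power)
  also have "\<dots> = (\<Sum>k. ennreal (pi * Suc k * (norm (c (Suc k)))\<^sup>2))"
  proof (rule suminf_cong)
    fix k
    have "norm (d k) = real (Suc k) * norm (c (Suc k))"
      by (simp only: d_def norm_mult norm_of_nat)
    then show "ennreal ((norm (d k))\<^sup>2) * ennreal (pi / (k + 1)) = ennreal (pi * Suc k * (norm (c (Suc k)))\<^sup>2)"
      by (simp add: power2_eq_square flip: ennreal_mult)
  qed
  also have "\<dots> = (\<Sum>k. ennreal (pi * k * (norm (c k))\<^sup>2))"
    by (subst suminf_offset[of "\<lambda>k. ennreal (pi * k * (norm (c k))\<^sup>2)" 1]) (simp_all add: summableI)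
  finally show ?thesis .
qed

text \<open>Fatou's lemma. It carries uniform bounds from partial sums to a limit whose integral is
  not known in advance to be finite.\<close>

lemma dirichlet_integral_le_of_tendsto:
  assumes hol: "\<And>n. g n holomorphic_on ball 0 1"
    and lim: "\<And>z. z \<in> ball 0 1 \<Longrightarrow> (\<lambda>n. deriv (g n) z) \<longlonglongrightarrow> deriv G z"
    and le: "\<And>n. dirichlet_integral (g n) \<le> X"
  shows "dirichlet_integral G \<le> X"
proof -
  let ?B = "ball (0::complex) 1"
  let ?h = "\<lambda>g z. ennreal ((norm (deriv g z))\<^sup>2) * indicator ?B z"
  have meas: "?h (g n) \<in> borel_measurable lborel" for n
    using borel_measurable_deriv_on_disc[OF hol] by simp
  have "dirichlet_integral G = (\<integral>\<^sup>+z. liminf (\<lambda>n. ?h (g n) z) \<partial>lborel)"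
    unfolding dirichlet_integral_def
  proof (rule nn_integral_cong)
    fix z
    have "(\<lambda>n. ?h (g n) z) \<longlonglongrightarrow> ?h G z"
    proof (cases "z \<in> ?B")
      case True
      have "(\<lambda>n. ennreal ((norm (deriv (g n) z))\<^sup>2)) \<longlonglongrightarrow> ennreal ((norm (deriv G z))\<^sup>2)"
        by (intro tendsto_intros lim True)
      then show ?thesis using True by simp
    qed simp
    then show "?h G z = liminf (\<lambda>n. ?h (g n) z)"
      by (rule lim_imp_Liminf[OF trivial_limit_sequentially, symmetric])
  qed
  also have "\<dots> \<le> liminf (\<lambda>n. dirichlet_integral (g n))"
    unfolding dirichlet_integral_def by (rule nn_integral_liminf[OF meas])
  also have "\<dots> \<le> liminf (\<lambda>n. X)"
    by (rule Liminf_mono) (simp add: le)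
  finally show ?thesis by (simp add: Liminf_const)
qed

text \<open>Fatou's lemma on each circle, followed by the supremum over the radii.\<close>

lemma hardy2_norm_sq_le_of_tendsto:
  assumes hol: "\<And>n. g n holomorphic_on ball 0 1"
    and lim: "\<And>z. z \<in> ball 0 1 \<Longrightarrow> (\<lambda>n. g n z) \<longlonglongrightarrow> G z"
    and le: "\<And>n. hardy2_norm_sq (g n) \<le> X"
  shows "hardy2_norm_sq G \<le> X"
  unfolding hardy2_norm_sq_def
proof (rule SUP_least)
  fix r :: real assume r: "r \<in> {0<..<1}"
  let ?h = "\<lambda>g t. ennreal ((norm (g (of_real r * cis t)))\<^sup>2 / (2 * pi)) * indicator {0..2*pi} t"
  have circ: "of_real r * cis t \<in> ball 0 1" for t using r by (simp add: norm_mult)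
  have meas: "?h (g n) \<in> borel_measurable lborel" for n
  proof -
    have "continuous_on UNIV (\<lambda>t. g n (of_real r * cis t))"
      by (rule continuous_on_compose2[OF holomorphic_on_imp_continuous_on[OF hol]])
        (use circ in \<open>auto simp: cis_conv_exp intro!: continuous_intros\<close>)
    then have "continuous_on UNIV (\<lambda>t. (norm (g n (of_real r * cis t)))\<^sup>2 / (2 * pi))"
      by (intro continuous_intros) auto
    from borel_measurable_continuous_onI[OF this]
    have "(\<lambda>t. ennreal ((norm (g n (of_real r * cis t)))\<^sup>2 / (2 * pi))) \<in> borel_measurable lborel"
      by (intro measurable_compose[OF _ measurable_ennreal]) simp
    then show ?thesis by (intro borel_measurable_times_ennreal borel_measurable_indicator) simp_all
  qed
  have "(\<integral>\<^sup>+t. ?h G t \<partial>lborel) = (\<integral>\<^sup>+t. liminf (\<lambda>n. ?h (g n) t) \<partial>lborel)"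
  proof (rule nn_integral_cong)
    fix t
    have "(\<lambda>n. ennreal ((norm (g n (of_real r * cis t)))\<^sup>2 / (2 * pi))) \<longlonglongrightarrow> ennreal ((norm (G (of_real r * cis t)))\<^sup>2 / (2 * pi))"
      by (intro tendsto_intros lim circ) simp
    then have "(\<lambda>n. ?h (g n) t) \<longlonglongrightarrow> ?h G t"
      by (cases "t \<in> {0..2*pi}") simp_all
    then show "?h G t = liminf (\<lambda>n. ?h (g n) t)"
      by (rule lim_imp_Liminf[OF trivial_limit_sequentially, symmetric])
  qed
  also have "\<dots> \<le> liminf (\<lambda>n. \<integral>\<^sup>+t. ?h (g n) t \<partial>lborel)"
    by (rule nn_integral_liminf[OF meas])
  also have "\<dots> \<le> liminf (\<lambda>n. X)"
  proof (rule Liminf_mono, rule always_eventually, rule allI)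
    fix n
    have "(\<integral>\<^sup>+t. ?h (g n) t \<partial>lborel) \<le> hardy2_norm_sq (g n)"
      unfolding hardy2_norm_sq_def by (rule SUP_upper[OF r])
    also note le
    finally show "(\<integral>\<^sup>+t. ?h (g n) t \<partial>lborel) \<le> X" .
  qed
  finally show "(\<integral>\<^sup>+t. ?h G t \<partial>lborel) \<le> X" by (simp add: Liminf_const)
qed

lemma holomorphic_imp_disc_series:
  assumes "g holomorphic_on ball 0 1"
  obtains c where "disc_series c g"
proof
  show "disc_series (\<lambda>k. (deriv ^^ k) g 0 / fact k) g"
    using holomorphic_power_series[OF assms] by (auto simp: disc_series_def)
qed

lemma disc_series_0: "disc_series c g \<Longrightarrow> c 0 = g 0"
  using disc_seriesD[of c g 0] powser_sums_zero[of c] sums_unique2 by fastforce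

lemma disc_series_1: "disc_series c g \<Longrightarrow> c 1 = deriv g 0"
  using disc_series_0[OF disc_series_deriv] by fastforce

lemma disc_series_drop_linear:
  assumes c: "disc_series c g"
  shows "disc_series (c(1 := 0)) (\<lambda>z. g z - c 1 * z)"
  unfolding disc_series_def
proof
  fix z :: complex assume "z \<in> ball 0 1"
  then have "(\<lambda>k. c k * z ^ k) sums g z" by (intro disc_seriesD[OF c]) simp
  moreover have "(\<lambda>k. if k = 1 then c 1 * z ^ k else 0) sums (c 1 * z ^ 1)"
    by (rule sums_single)
  ultimately have "(\<lambda>k. c k * z ^ k - (if k = 1 then c 1 * z ^ k else 0)) sums (g z - c 1 * z ^ 1)"
    by (rule sums_diff)
  moreover have "c k * z ^ k - (if k = 1 then c 1 * z ^ k else 0) = (c(1 := 0)) k * z ^ k" for k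
    by simp
  ultimately show "(\<lambda>k. (c(1 := 0)) k * z ^ k) sums (g z - c 1 * z)" by simp
qed

lemma suminf_ennreal_remove:
  fixes x :: "nat \<Rightarrow> ennreal"
  shows "(\<Sum>k. x k) = x i + (\<Sum>k. (x(i := 0)) k)"
proof -
  have "(\<Sum>k. x k) = (\<Sum>k. (if k = i then x i else 0) + (x(i := 0)) k)"
    by (intro suminf_cong) auto
  also have "\<dots> = (\<Sum>k. if k = i then x i else 0) + (\<Sum>k. (x(i := 0)) k)"
    by (rule suminf_add[symmetric]) (auto intro: summableI)
  also have "(\<Sum>k. if k = i then x i else 0) = x i"
    using sums_single[of i "\<lambda>_. x i"] by (simp add: sums_iff)
  finally show ?thesis .
qed

text \<open>The monomial \<open>z\<close> is orthogonal to all others. Two functions that differ by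
  a multiple of \<open>z\<close> share the last summand, and comparing their splittings is what
  produces the recursion.\<close>

lemma dirichlet_integral_split_linear:
  assumes g: "g holomorphic_on ball 0 1"
  shows "dirichlet_integral g = ennreal (pi * (norm (deriv g 0))\<^sup>2) + dirichlet_integral (\<lambda>z. g z - deriv g 0 * z)"
proof -
  obtain c where c: "disc_series c g" using holomorphic_imp_disc_series[OF g] .
  note c1 = disc_series_1[OF c]
  have "dirichlet_integral g = ennreal (pi * (norm (c 1))\<^sup>2)
      + (\<Sum>k. ((\<lambda>k. ennreal (pi * real k * (norm (c k))\<^sup>2)) (1 := 0)) k)"
    unfolding dirichlet_integral_coeffs[OF c] by (subst suminf_ennreal_remove[of _ 1]) simp
  also have "(\<Sum>k. ((\<lambda>k. ennreal (pi * real k * (norm (c k))\<^sup>2)) (1 := 0)) k)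
      = dirichlet_integral (\<lambda>z. g z - c 1 * z)"
    unfolding dirichlet_integral_coeffs[OF disc_series_drop_linear[OF c]] by (intro suminf_cong) auto
  finally show ?thesis unfolding c1 .
qed

lemma hardy2_norm_sq_split_linear:
  assumes g: "g holomorphic_on ball 0 1"
  shows "hardy2_norm_sq g = ennreal ((norm (deriv g 0))\<^sup>2) + hardy2_norm_sq (\<lambda>z. g z - deriv g 0 * z)"
proof -
  obtain c where c: "disc_series c g" using holomorphic_imp_disc_series[OF g] .
  note c1 = disc_series_1[OF c]
  have "hardy2_norm_sq g = ennreal ((norm (c 1))\<^sup>2) + (\<Sum>k. ((\<lambda>k. ennreal ((norm (c k))\<^sup>2)) (1 := 0)) k)"
    unfolding hardy2_norm_sq_coeffs[OF c] by (subst suminf_ennreal_remove[of _ 1]) simp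
  also have "(\<Sum>k. ((\<lambda>k. ennreal ((norm (c k))\<^sup>2)) (1 := 0)) k) = hardy2_norm_sq (\<lambda>z. g z - c 1 * z)"
    unfolding hardy2_norm_sq_coeffs[OF disc_series_drop_linear[OF c]] by (intro suminf_cong) auto
  finally show ?thesis unfolding c1 .
qed

subsection \<open>Orthogonality in the Dirichlet space\<close>

lemma Cauchy_theorem_circle_disc:
  assumes "g holomorphic_on ball 0 1" "0 < s" "s < 1"
  shows "(g has_contour_integral 0) (circlepath 0 s)"
  by (rule Cauchy_theorem_disc_simple[OF assms(1)]) (use assms in auto)

text \<open>Multiplying by \<open>z\<close> avoids the index shift of differentiation, and this
  \<open>z\<close> is supplied by \<open>dz = i z dt\<close> on a circle.\<close>

lemma disc_series_z_deriv:
  assumes c: "disc_series c g"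
  shows "disc_series (\<lambda>k. of_nat k * c k) (\<lambda>z. z * deriv g z)"
  unfolding disc_series_def
proof
  fix z :: complex assume "z \<in> ball 0 1"
  then have "(\<lambda>k. of_nat (Suc k) * c (Suc k) * z ^ k) sums deriv g z"
    by (intro disc_seriesD[OF disc_series_deriv[OF c]]) simp
  then have "(\<lambda>k. z * (of_nat (Suc k) * c (Suc k) * z ^ k)) sums (z * deriv g z)"
    by (rule sums_mult)
  also have "(\<lambda>k. z * (of_nat (Suc k) * c (Suc k) * z ^ k)) = (\<lambda>k. of_nat (Suc k) * c (Suc k) * z ^ Suc k)"
    by (simp add: fun_eq_iff)
  finally show "(\<lambda>k. of_nat k * c k * z ^ k) sums (z * deriv g z)"
    by (subst (asm) sums_Suc_iff) simp
qed

lemma disc_series_sum: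
  assumes "\<And>i. i \<in> I \<Longrightarrow> disc_series (c i) (g i)"
  shows "disc_series (\<lambda>k. \<Sum>i\<in>I. h i * c i k) (\<lambda>z. \<Sum>i\<in>I. h i * g i z)"
  unfolding disc_series_def
proof
  fix z :: complex assume "z \<in> ball 0 1"
  then have "(\<lambda>k. \<Sum>i\<in>I. h i * (c i k * z ^ k)) sums (\<Sum>i\<in>I. h i * g i z)"
    using assms by (intro sums_sum sums_mult disc_seriesD) auto
  then show "(\<lambda>k. (\<Sum>i\<in>I. h i * c i k) * z ^ k) sums (\<Sum>i\<in>I. h i * g i z)"
    by (simp add: sum_distrib_right mult.assoc)
qed

lemma disc_series_add:
  assumes "disc_series c g" "disc_series d h"
  shows "disc_series (\<lambda>k. c k + d k) (\<lambda>z. g z + h z)"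
  using assms by (auto simp: disc_series_def distrib_right intro!: sums_add)

text \<open>Since \<open>u\<close> extends beyond the closed disc, its conjugate on the unit circle continues inwards as
  \<open>cnj (u (1 / cnj z))\<close>. The pairing thus becomes a contour integral over \<open>|z| = s < 1\<close>, and \<open>W\<close> need
  not have boundary values.\<close>

lemma dirichlet_pairing:
  assumes w: "disc_series w W"
    and s: "0 < s" "s < 1"
    and b: "\<And>z. norm z < R \<Longrightarrow> (\<lambda>k. b k * z ^ k) sums u z" and R: "1 / s < R"
    and refl: "\<And>z. norm z = s \<Longrightarrow> deriv W z * cnj (u (1 / cnj z)) = Q z"
    and Q: "(Q has_contour_integral (2 * pi * \<i> * I)) (circlepath 0 s)"
  shows "(\<lambda>k. of_nat k * w k * cnj (b k)) sums I"
proof -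
  define A where "A k = of_nat k * w k * of_real s ^ k" for k
  \<comment> \<open>\<open>A\<close> belongs to radius \<open>s\<close> and \<open>B\<close> to the
    reflected radius \<open>1 / s\<close>, so the powers of \<open>s\<close> cancel in
    \<open>A k * cnj (B k)\<close>.\<close>
  define B where "B k = b k * of_real (1 / s) ^ k" for k
  have A: "summable (\<lambda>k. norm (A k))"
    unfolding A_def by (rule summable_norm_power_series[OF disc_series_z_deriv[OF w]]) (use s in simp)
  have B: "summable (\<lambda>k. norm (B k))"
  proof -
    obtain r where r: "1 / s < r" "r < R" using R dense by blast
    then have "0 < r" using s by (meson less_trans zero_less_divide_1_iff)
    then have "norm (complex_of_real r) < R" using r by simp
    from sums_summable[OF b[OF this]] show ?thesis
      unfolding B_def by (rule powser_insidea) (use r s \<open>0 < r\<close> in \<open>simp add: norm_divide\<close>)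
  qed
  have AB: "A k * cnj (B k) = of_nat k * w k * cnj (b k)" for k
    using s by (simp add: A_def B_def power_divide)
  have A_sum: "(\<Sum>k. A k * cis (real k * t)) = of_real s * cis t * deriv W (of_real s * cis t)" for t
  proof -
    have "norm (of_real s * cis t) < 1" using s by (simp add: norm_mult)
    from disc_seriesD[OF disc_series_z_deriv[OF w] this] show ?thesis
      by (simp add: sums_iff A_def power_mult_distrib Complex.DeMoivre mult.assoc)
  qed
  have B_sum: "(\<Sum>k. B k * cis (real k * t)) = u (1 / cnj (of_real s * cis t))" for t
  proof -
    have e: "of_real (1 / s) * cis t = 1 / cnj (of_real s * cis t)"
      by (simp add: cis_cnj divide_inverse)
    have "norm (of_real (1 / s) * cis t) < R" using s R by (simp add: norm_mult norm_divide)
    from b[OF this] show ?thesis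
      unfolding e[symmetric] by (simp add: sums_iff B_def power_divide Complex.DeMoivre)
  qed
  have "((\<lambda>t. Q (0 + of_real s * cis t) * of_real s * \<i> * cis t) has_integral (2 * pi * \<i> * I)) {0..2*pi}"
    using Q has_contour_integral_part_circlepath_iff[of 0 "2 * pi"] by (simp add: circlepath_def)
  \<comment> \<open>Since \<open>dz = i z dt\<close>, the factor \<open>-i\<close> leaves
    \<open>z * Q z\<close>, whose \<open>z\<close> completes \<open>deriv W\<close> to the function
    with coefficients \<open>k * w k\<close>.\<close>
  from has_integral_mult_right[OF this, of "- \<i>"]
  have "((\<lambda>t. of_real s * cis t * Q (of_real s * cis t)) has_integral (2 * pi * I)) {0..2*pi}"
    by (simp add: mult_ac)
  also have "(\<lambda>t. of_real s * cis t * Q (of_real s * cis t)) = (\<lambda>t. (\<Sum>k. A k * cis (real k * t)) * cnj (\<Sum>k. B k * cis (real k * t)))"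
  proof
    fix t
    have "norm (of_real s * cis t) = s" using s by (simp add: norm_mult)
    from refl[OF this]
    show "of_real s * cis t * Q (of_real s * cis t) = (\<Sum>k. A k * cis (real k * t)) * cnj (\<Sum>k. B k * cis (real k * t))"
      unfolding A_sum B_sum by (simp only: mult.assoc)
  qed
  finally have "2 * pi * I = 2 * pi * (\<Sum>k. A k * cnj (B k))"
    using circle_parseval[OF A B] by (rule has_integral_unique)
  moreover have "(\<lambda>k. A k * cnj (B k)) sums (\<Sum>k. A k * cnj (B k))"
    by (rule summable_sums[OF summable_mult_cnj[OF A B]])
  ultimately show ?thesis unfolding AB by simp
qed

text \<open>If \<open>y\<close> is not summable, both sides are infinite, since \<open>x\<close> and
  \<open>e\<close> are summable. The cross terms \<open>e\<close> may have either sign, hence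
  nonnegativity is asked of the whole term.\<close>

lemma suminf_ennreal_pythagoras:
  fixes x y e :: "nat \<Rightarrow> real"
  assumes nn: "\<And>k. 0 \<le> x k" "\<And>k. 0 \<le> y k" "\<And>k. 0 \<le> x k + y k + e k"
    and x: "summable x" and e: "e sums 0"
  shows "(\<Sum>k. ennreal (x k + y k + e k)) = (\<Sum>k. ennreal (x k)) + (\<Sum>k. ennreal (y k))"
proof (cases "summable y")
  case True
  have "(\<lambda>k. x k + y k + e k) sums (suminf x + suminf y + 0)"
    by (intro sums_add summable_sums x True e)
  then show ?thesis
    using suminf_ennreal2[OF nn(1) x] suminf_ennreal2[OF nn(2) True] suminf_ennreal2[OF nn(3)]
      suminf_nonneg[OF x nn(1)] suminf_nonneg[OF True nn(2)]
    by (simp add: sums_iff)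
next
  case False
  have "\<not> summable (\<lambda>k. x k + y k + e k)"
  proof
    assume "summable (\<lambda>k. x k + y k + e k)"
    then have "summable (\<lambda>k. (x k + y k + e k) - x k - e k)"
      using x e by (intro summable_diff) (auto simp: sums_iff)
    with False show False by simp
  qed
  then have "(\<Sum>k. ennreal (x k + y k + e k)) = top"
    using summable_suminf_not_top[of "\<lambda>k. x k + y k + e k", OF nn(3)] by blast
  moreover have "(\<Sum>k. ennreal (y k)) = top"
    using False summable_suminf_not_top[of y, OF nn(2)] by blast
  ultimately show ?thesis by simp
qed

text \<open>Finiteness is asked of \<open>P\<close> alone: \<open>P\<close> will be a polynomial in
  \<open>B\<close>, while \<open>W\<close> is a remainder whose integral may be infinite.\<close>

lemma dirichlet_integral_pythagoras:
  assumes p: "disc_series p P" and w: "disc_series w W"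
    and orth: "(\<lambda>k. of_nat k * w k * cnj (p k)) sums 0" and fin: "dirichlet_integral P < \<infinity>"
  shows "dirichlet_integral (\<lambda>z. P z + W z) = dirichlet_integral P + dirichlet_integral W"
proof -
  define x where "x k = pi * real k * (norm (p k))\<^sup>2" for k
  define y where "y k = pi * real k * (norm (w k))\<^sup>2" for k
  define e where "e k = 2 * pi * Re (of_nat k * w k * cnj (p k))" for k
  have eq: "pi * real k * (norm (p k + w k))\<^sup>2 = x k + y k + e k" for k
    unfolding x_def y_def e_def cmod_power2 by (simp add: power2_eq_square algebra_simps)
  have "(\<Sum>k. ennreal (x k + y k + e k)) = (\<Sum>k. ennreal (x k)) + (\<Sum>k. ennreal (y k))"
  proof (rule suminf_ennreal_pythagoras)
    show "0 \<le> x k + y k + e k" for k unfolding eq[symmetric] by simp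
    show "summable x"
      by (rule summable_suminf_not_top) (use fin dirichlet_integral_coeffs[OF p] in \<open>auto simp: x_def\<close>)
    show "e sums 0"
      unfolding e_def using sums_mult[OF sums_Re[OF orth], of "2 * pi"] by simp
  qed (auto simp: x_def y_def)
  then show ?thesis
    unfolding dirichlet_integral_coeffs[OF p] dirichlet_integral_coeffs[OF w]
      dirichlet_integral_coeffs[OF disc_series_add[OF p w]] eq x_def y_def .
qed

subsection \<open>Composition with a Blaschke product\<close>

lemma dirichlet_integral_cong:
  assumes "\<And>z. z \<in> ball 0 1 \<Longrightarrow> f z = g z"
  shows "dirichlet_integral f = dirichlet_integral g"
proof -
  have "deriv f z = deriv g z" if "z \<in> ball 0 1" for z
  proof (rule deriv_cong_ev)
    show "\<forall>\<^sub>F w in nhds z. f w = g w"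
      using eventually_nhds_in_open[OF open_ball that] by eventually_elim (rule assms)
  qed simp
  then show ?thesis
    unfolding dirichlet_integral_def by (intro nn_integral_cong) (auto simp: indicator_def)
qed

lemma hardy2_norm_sq_cong:
  assumes "\<And>z. z \<in> ball 0 1 \<Longrightarrow> f z = g z"
  shows "hardy2_norm_sq f = hardy2_norm_sq g"
  unfolding hardy2_norm_sq_def
proof (rule SUP_cong)
  fix r :: real assume "r \<in> {0<..<1}"
  then have "f (of_real r * cis t) = g (of_real r * cis t)" for t
    by (intro assms) (simp add: norm_mult)
  then show "(\<integral>\<^sup>+t\<in>{0..2*pi}. ennreal ((norm (f (of_real r * cis t)))\<^sup>2 / (2 * pi)) \<partial>lborel)
      = (\<integral>\<^sup>+t\<in>{0..2*pi}. ennreal ((norm (g (of_real r * cis t)))\<^sup>2 / (2 * pi)) \<partial>lborel)"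
    by (simp only:)
qed simp

text \<open>Logarithmic derivatives add; the form \<open>f z * p\<close> avoids dividing by
  \<open>f z\<close>.\<close>

lemma log_derivative_mult:
  assumes "(f has_field_derivative f z * p) (at z)" "(g has_field_derivative g z * q) (at z)"
  shows "((\<lambda>z. f z * g z) has_field_derivative f z * g z * (p + q)) (at z)"
  using DERIV_mult[OF assms] by (simp add: algebra_simps)

locale blaschke =
  fixes N :: nat and c :: complex and \<alpha> :: "nat \<Rightarrow> complex"
  assumes N_pos: "0 < N" and norm_c: "norm c = 1" and norm_\<alpha>: "k < N \<Longrightarrow> norm (\<alpha> k) < 1"
begin

text \<open>The function of the theorem is known only in the disc. \<open>B\<close> is given by the
  rational formula on the whole plane, so it can also be evaluated at the reflected points
  \<open>1 / cnj z\<close>.\<close>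

definition B :: "complex \<Rightarrow> complex" where
  "B z = c * (\<Prod>k<N. (z - \<alpha> k) / (1 - cnj (\<alpha> k) * z))"

definition log_derivative :: "complex \<Rightarrow> complex" where
  "log_derivative z = (\<Sum>k<N. 1 / (z - \<alpha> k) + cnj (\<alpha> k) / (1 - cnj (\<alpha> k) * z))"

lemma denominator_nonzero: "norm (\<alpha> k) * norm z < 1 \<Longrightarrow> 1 - cnj (\<alpha> k) * z \<noteq> 0"
  by (metis complex_mod_cnj norm_mult norm_one order_less_irrefl right_minus_eq)

lemma denominator_nonzero_disc: "k < N \<Longrightarrow> norm z < 1 \<Longrightarrow> 1 - cnj (\<alpha> k) * z \<noteq> 0"
  using denominator_nonzero[of k z] norm_\<alpha>[of k] mult_le_one[of "norm (\<alpha> k)" "norm z"]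
    mult_strict_mono[of "norm (\<alpha> k)" 1 "norm z" 1] by fastforce

lemma norm_B_less_1:
  assumes z: "norm z < 1"
  shows "norm (B z) < 1"
proof -
  have *: "norm ((z - \<alpha> k) / (1 - cnj (\<alpha> k) * z)) < 1" if "k < N" for k
    using Moebius_function_norm_lt_1[OF norm_\<alpha>[OF that] z, of 0] by (simp add: Moebius_function_def)
  have "norm (B z) = (\<Prod>k<N. norm ((z - \<alpha> k) / (1 - cnj (\<alpha> k) * z)))"
    by (simp add: B_def norm_mult norm_c prod_norm)
  also have "\<dots> < (\<Prod>k<N. 1)"
    by (rule prod_mono_strict[where i = 0]) (use * N_pos in \<open>auto intro: less_imp_le\<close>)
  finally show ?thesis by simp
qed

text \<open>The poles of \<open>B\<close> are reflections of its nonzero zeros, so \<open>B\<close>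
  is holomorphic for \<open>|z| < 1 / s'\<close>. The gap between \<open>s'\<close> and
  \<open>s\<close> places the reflected circle of radius \<open>1 / s\<close> strictly inside that
  disc, while the circle of radius \<open>s\<close> still encloses every zero.\<close>

lemma radii:
  obtains s s' where "0 < s'" "s' < s" "s < 1" "\<And>k. k < N \<Longrightarrow> norm (\<alpha> k) < s'"
proof -
  define M where "M = Max (insert 0 ((\<lambda>k. norm (\<alpha> k)) ` {..<N}))"
  have "M < 1" unfolding M_def using norm_\<alpha> by (subst Max_less_iff) auto
  moreover have "0 \<le> M" unfolding M_def by (rule Max_ge) auto
  moreover have le: "norm (\<alpha> k) \<le> M" if "k < N" for k
    unfolding M_def using that by (intro Max_ge) auto
  moreover obtain s' where "M < s'" "s' < 1" using \<open>M < 1\<close> dense by blast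
  moreover obtain s where "s' < s" "s < 1" using \<open>s' < 1\<close> dense by blast
  ultimately show thesis by (intro that[of s' s]) (auto intro: le_less_trans)
qed

lemma holomorphic_B:
  assumes "\<And>k. k < N \<Longrightarrow> norm (\<alpha> k) < s'" "0 < s'"
  shows "B holomorphic_on ball 0 (1 / s')"
proof -
  have "1 - cnj (\<alpha> k) * z \<noteq> 0" if "k < N" "z \<in> ball 0 (1 / s')" for k z
  proof (rule denominator_nonzero)
    have "norm z < 1 / s'" using that by simp
    then have "norm (\<alpha> k) * norm z < s' * (1 / s')"
      using assms(1)[OF that(1)] assms(2) by (intro mult_strict_mono) auto
    then show "norm (\<alpha> k) * norm z < 1" using assms(2) by simp
  qed
  then show ?thesis
    unfolding B_def by (intro holomorphic_intros) auto
qed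

lemma holomorphic_B_disc: "B holomorphic_on ball 0 1"
  unfolding B_def by (intro holomorphic_intros) (use denominator_nonzero_disc in auto)

text \<open>Schwarz reflection of \<open>|B| = 1\<close> on the unit circle. The identity cancels
  factor by factor: reflecting a factor exchanges its numerator and denominator.\<close>

lemma B_reflect:
  assumes "norm z < 1" "z \<noteq> 0" "\<And>k. k < N \<Longrightarrow> z \<noteq> \<alpha> k"
  shows "B z * cnj (B (1 / cnj z)) = 1"
proof -
  have "(z - \<alpha> k) / (1 - cnj (\<alpha> k) * z) * cnj ((1 / cnj z - \<alpha> k) / (1 - cnj (\<alpha> k) * (1 / cnj z))) = 1"
    if k: "k < N" for k
  proof -
    have nz: "1 - cnj (\<alpha> k) * z \<noteq> 0" "z - \<alpha> k \<noteq> 0"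
      using denominator_nonzero_disc[OF k assms(1)] assms(3)[OF k] by auto
    have "cnj ((1 / cnj z - \<alpha> k) / (1 - cnj (\<alpha> k) * (1 / cnj z))) = (1 / z - cnj (\<alpha> k)) / (1 - \<alpha> k / z)"
      by simp
    also have "\<dots> = ((1 - cnj (\<alpha> k) * z) / z) / ((z - \<alpha> k) / z)"
      using assms(2) by (simp add: diff_divide_distrib)
    also have "\<dots> = (1 - cnj (\<alpha> k) * z) / (z - \<alpha> k)" using assms(2) by simp
    finally show ?thesis using nz by simp
  qed
  then have "(\<Prod>k<N. (z - \<alpha> k) / (1 - cnj (\<alpha> k) * z) * cnj ((1 / cnj z - \<alpha> k) / (1 - cnj (\<alpha> k) * (1 / cnj z)))) = 1"
    by (intro prod.neutral) auto
  moreover have "c * cnj c = 1" using complex_norm_square[of c] norm_c by simp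
  ultimately show ?thesis
    unfolding B_def complex_cnj_mult cnj_prod prod.distrib by (simp add: mult_ac)
qed

lemma B_has_log_derivative:
  assumes "norm z < 1" "\<And>k. k < N \<Longrightarrow> z \<noteq> \<alpha> k"
  shows "(B has_field_derivative B z * log_derivative z) (at z)"
proof -
  have "((\<lambda>z. \<Prod>k<n. (z - \<alpha> k) / (1 - cnj (\<alpha> k) * z)) has_field_derivative
      (\<Prod>k<n. (z - \<alpha> k) / (1 - cnj (\<alpha> k) * z)) * (\<Sum>k<n. 1 / (z - \<alpha> k) + cnj (\<alpha> k) / (1 - cnj (\<alpha> k) * z))) (at z)"
    if "n \<le> N" for n
    using that
  proof (induction n)
    case 0
    then show ?case by simp
  next
    case (Suc n)
    have nz: "1 - cnj (\<alpha> n) * z \<noteq> 0" "z - \<alpha> n \<noteq> 0"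
      using denominator_nonzero_disc[of n z] assms Suc.prems by auto
    have "((\<lambda>z. (z - \<alpha> n) / (1 - cnj (\<alpha> n) * z)) has_field_derivative
       (z - \<alpha> n) / (1 - cnj (\<alpha> n) * z) * (1 / (z - \<alpha> n) + cnj (\<alpha> n) / (1 - cnj (\<alpha> n) * z))) (at z)"
    proof -
      define u where "u = z - \<alpha> n"
      define v where "v = 1 - cnj (\<alpha> n) * z"
      have "((\<lambda>z. (z - \<alpha> n) / (1 - cnj (\<alpha> n) * z)) has_field_derivative (v + u * cnj (\<alpha> n)) / (v * v)) (at z)"
        using nz unfolding u_def v_def by (auto intro!: derivative_eq_intros)
      also have "(v + u * cnj (\<alpha> n)) / (v * v) = u / v * (1 / u + cnj (\<alpha> n) / v)"
        using nz[folded u_def v_def] by (simp add: field_simps)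
      finally show ?thesis unfolding u_def v_def .
    qed
    from log_derivative_mult[OF Suc.IH this] Suc.prems show ?case
      by (simp only: prod.lessThan_Suc sum.lessThan_Suc Suc_leD)
  qed
  from DERIV_cmult[OF this[OF order_refl], of c] show ?thesis
    unfolding B_def[abs_def] log_derivative_def by (simp add: mult.assoc)
qed

text \<open>Each pole \<open>1 / (z - \<alpha> k)\<close> inside the circle contributes
  \<open>2 * pi * i\<close>, repeated zeros being counted repeatedly; the other summands are
  holomorphic in the disc and contribute nothing.\<close>

lemma log_derivative_contour_integral:
  assumes "0 < s" "s < 1" "\<And>k. k < N \<Longrightarrow> norm (\<alpha> k) < s"
  shows "(log_derivative has_contour_integral 2 * pi * \<i> * of_nat N) (circlepath 0 s)"
proof -
  have "((\<lambda>z. 1 / (z - \<alpha> k) + cnj (\<alpha> k) / (1 - cnj (\<alpha> k) * z)) has_contour_integral (2 * pi * \<i> + 0)) (circlepath 0 s)"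
    if k: "k < N" for k
  proof (rule has_contour_integral_add)
    show "((\<lambda>z. 1 / (z - \<alpha> k)) has_contour_integral 2 * pi * \<i>) (circlepath 0 s)"
      using Cauchy_integral_circlepath_simple[of "\<lambda>_. 1" 0 s "\<alpha> k"] assms(3)[OF k] by simp
    show "((\<lambda>z. cnj (\<alpha> k) / (1 - cnj (\<alpha> k) * z)) has_contour_integral 0) (circlepath 0 s)"
      by (rule Cauchy_theorem_circle_disc[OF _ assms(1,2)])
        (use denominator_nonzero_disc[OF k] in \<open>auto intro!: holomorphic_intros\<close>)
  qed
  then have "(log_derivative has_contour_integral (\<Sum>k<N. 2 * pi * \<i> + 0)) (circlepath 0 s)"
    unfolding log_derivative_def[abs_def] by (intro has_contour_integral_sum) auto
  then show ?thesis by (simp add: mult_ac)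
qed

text \<open>Both relations come from the contour pairing. Against the reflected \<open>B^j\<close>,
  the derivative of \<open>B^j\<close> leaves \<open>j\<close> times the logarithmic derivative,
  which has integral \<open>2 * pi * i * j * N\<close>. The derivative of \<open>B^(j+1) * V\<close>
  still contains \<open>B^j\<close>, which the reflection cancels, leaving a holomorphic function
  and hence 0 by Cauchy. The auxiliary radii stay hidden in the proof.\<close>

lemma power_coefficients:
  obtains b where "\<And>j. disc_series (b j) (\<lambda>z. B z ^ j)"
    and "\<And>j. (\<lambda>k. of_nat k * b j k * cnj (b j k)) sums (of_nat j * of_nat N)"
    and "\<And>j V w. V holomorphic_on ball 0 1 \<Longrightarrow> disc_series w (\<lambda>z. B z ^ Suc j * V z) \<Longrightarrow>
           (\<lambda>k. of_nat k * w k * cnj (b j k)) sums 0"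
proof -
  obtain s s' where s: "0 < s'" "s' < s" "s < 1" and \<alpha>: "\<And>k. k < N \<Longrightarrow> norm (\<alpha> k) < s'"
    by (rule radii) (rule that)
  have s0: "0 < s" using s by linarith
  have R: "1 / s < 1 / s'" "1 < 1 / s'" using s by (auto simp: field_simps)
  \<comment> \<open>These are the Taylor coefficients at 0, but the expansion converges in the
    larger disc of radius \<open>1 / s'\<close>, as the pairing requires at
    \<open>1 / cnj z\<close>.\<close>
  define b where "b j k = (deriv ^^ k) (\<lambda>z. B z ^ j) 0 / fact k" for j k
  have b: "(\<lambda>k. b j k * z ^ k) sums (B z ^ j)" if "norm z < 1 / s'" for j z
    using holomorphic_power_series[of "\<lambda>z. B z ^ j" 0 "1 / s'" z] that
      holomorphic_on_power[OF holomorphic_B[OF \<alpha> s(1)]] by (simp add: b_def)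
  have db: "disc_series (b j) (\<lambda>z. B z ^ j)" for j
    unfolding disc_series_def using b R(2) by auto
  have circ: "norm z < 1" "z \<noteq> 0" "z \<noteq> \<alpha> k" if "norm z = s" "k < N" for z k
    using that s s0 \<alpha>[OF that(2)] by auto
  have refl: "B z ^ j * cnj (B (1 / cnj z) ^ j) = 1" if z: "norm z = s" for z j
    using B_reflect[of z] circ[OF z] N_pos by (simp flip: power_mult_distrib)
  show thesis
  proof (rule that)
    fix j
    show "disc_series (b j) (\<lambda>z. B z ^ j)" by (rule db)
    show "(\<lambda>k. of_nat k * b j k * cnj (b j k)) sums (of_nat j * of_nat N)"
    proof (rule dirichlet_pairing[OF db s0 s(3) b R(1)])
      fix z :: complex assume z: "norm z = s"
      have "((\<lambda>z. B z ^ j) has_field_derivative of_nat j * (B z * log_derivative z * B z ^ (j - 1))) (at z)"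
        using DERIV_power[OF B_has_log_derivative[of z], of j] circ[OF z] N_pos by simp
      then have "deriv (\<lambda>z. B z ^ j) z = of_nat j * (B z * log_derivative z * B z ^ (j - 1))" by (rule DERIV_imp_deriv)
      also have "\<dots> = of_nat j * log_derivative z * B z ^ j" by (cases j) auto
      finally have "deriv (\<lambda>z. B z ^ j) z * cnj (B (1 / cnj z) ^ j) = of_nat j * log_derivative z * (B z ^ j * cnj (B (1 / cnj z) ^ j))"
        by (simp only: mult.assoc)
      then show "deriv (\<lambda>z. B z ^ j) z * cnj (B (1 / cnj z) ^ j) = of_nat j * log_derivative z" unfolding refl[OF z] by simp
    next
      have "(log_derivative has_contour_integral 2 * pi * \<i> * of_nat N) (circlepath 0 s)"
        by (rule log_derivative_contour_integral[OF s0 s(3)]) (use \<alpha> s(2) in \<open>auto intro: less_trans\<close>)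
      from has_contour_integral_lmul[OF this, of "of_nat j"]
      show "((\<lambda>z. of_nat j * log_derivative z) has_contour_integral (2 * pi * \<i> * (of_nat j * of_nat N))) (circlepath 0 s)"
        by (simp add: mult_ac)
    qed
  next
    fix j V w
    assume V: "V holomorphic_on ball 0 1" and w: "disc_series w (\<lambda>z. B z ^ Suc j * V z)"
    show "(\<lambda>k. of_nat k * w k * cnj (b j k)) sums 0"
    proof (rule dirichlet_pairing[OF w s0 s(3) b R(1)])
      fix z :: complex assume z: "norm z = s"
      have z1: "z \<in> ball 0 1" using z s by simp
      have dB: "(B has_field_derivative deriv B z) (at z)" and dV: "(V has_field_derivative deriv V z) (at z)"
        using holomorphic_derivI[OF holomorphic_B_disc open_ball z1] holomorphic_derivI[OF V open_ball z1] by auto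
      have "((\<lambda>z. B z ^ Suc j * V z) has_field_derivative B z ^ j * (of_nat (Suc j) * deriv B z * V z + B z * deriv V z)) (at z)"
        using DERIV_mult[OF DERIV_power[OF dB, of "Suc j"] dV] by (simp add: algebra_simps)
      then have "deriv (\<lambda>z. B z ^ Suc j * V z) z = B z ^ j * (of_nat (Suc j) * deriv B z * V z + B z * deriv V z)"
        by (rule DERIV_imp_deriv)
      then have "deriv (\<lambda>z. B z ^ Suc j * V z) z * cnj (B (1 / cnj z) ^ j)
         = (B z ^ j * cnj (B (1 / cnj z) ^ j)) * (of_nat (Suc j) * deriv B z * V z + B z * deriv V z)"
        by (simp only: mult_ac)
      then show "deriv (\<lambda>z. B z ^ Suc j * V z) z * cnj (B (1 / cnj z) ^ j) = of_nat (Suc j) * deriv B z * V z + B z * deriv V z"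
        unfolding refl[OF z] by simp
    next
      show "((\<lambda>z. of_nat (Suc j) * deriv B z * V z + B z * deriv V z) has_contour_integral (2 * pi * \<i> * 0)) (circlepath 0 s)"
        unfolding mult_zero_right
        by (rule Cauchy_theorem_circle_disc[OF _ s0 s(3)])
          (intro holomorphic_intros holomorphic_deriv holomorphic_B_disc V open_ball)
    qed
  qed
qed

text \<open>A finite section of \<open>h \<circ> B\<close> together with a remainder divisible by
  \<open>B^J\<close>. Orthogonality makes the remainder contribute additively, even when its
  integral is infinite.\<close>

lemma dirichlet_integral_polynomial_compose_split:
  assumes V: "V holomorphic_on ball 0 1"
  shows "dirichlet_integral (\<lambda>z. \<Sum>j<J. h j * B z ^ j) = ennreal (pi * N * (\<Sum>j<J. real j * (norm (h j))\<^sup>2))" (is ?poly)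
    and "dirichlet_integral (\<lambda>z. (\<Sum>j<J. h j * B z ^ j) + B z ^ J * V z)
      = ennreal (pi * N * (\<Sum>j<J. real j * (norm (h j))\<^sup>2)) + dirichlet_integral (\<lambda>z. B z ^ J * V z)" (is ?split)
proof -
  obtain b where b: "\<And>j. disc_series (b j) (\<lambda>z. B z ^ j)"
    and bb: "\<And>j. (\<lambda>k. of_nat k * b j k * cnj (b j k)) sums (of_nat j * of_nat N)"
    and orth: "\<And>j V w. V holomorphic_on ball 0 1 \<Longrightarrow> disc_series w (\<lambda>z. B z ^ Suc j * V z) \<Longrightarrow>
           (\<lambda>k. of_nat k * w k * cnj (b j k)) sums 0"
    by (rule power_coefficients) (rule that)
  \<comment> \<open>General in \<open>J\<close> and \<open>V\<close> because the induction for the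
    polynomial formula applies it with the constant \<open>V = h J\<close>; finiteness of the
    polynomial part is then supplied by the induction hypothesis.\<close>
  have split: "dirichlet_integral (\<lambda>z. (\<Sum>j<J. h j * B z ^ j) + B z ^ J * V z)
      = dirichlet_integral (\<lambda>z. \<Sum>j<J. h j * B z ^ j) + dirichlet_integral (\<lambda>z. B z ^ J * V z)"
    if fin: "dirichlet_integral (\<lambda>z. \<Sum>j<J. h j * B z ^ j) < \<infinity>" and V: "V holomorphic_on ball 0 1" for J V
  proof -
    have "(\<lambda>z. B z ^ J * V z) holomorphic_on ball 0 1"
      by (intro holomorphic_intros holomorphic_B_disc V)
    then obtain w where w: "disc_series w (\<lambda>z. B z ^ J * V z)" by (rule holomorphic_imp_disc_series)
    show ?thesis
    proof (rule dirichlet_integral_pythagoras[OF disc_series_sum[OF b] w _ fin])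
      have "(\<lambda>k. \<Sum>j<J. cnj (h j) * (of_nat k * w k * cnj (b j k))) sums (\<Sum>j<J. cnj (h j) * 0)"
      proof (intro sums_sum sums_mult)
        fix j assume j: "j \<in> {..<J}"
        \<comment> \<open>One factor \<open>B^(j+1)\<close> is isolated and the surplus powers go
          into the holomorphic cofactor, to match the orthogonality relation.\<close>
        have e: "(\<lambda>z. B z ^ J * V z) = (\<lambda>z. B z ^ Suc j * (B z ^ (J - Suc j) * V z))"
          using j by (simp add: mult.assoc[symmetric] flip: power_add power_Suc)
        show "(\<lambda>k. of_nat k * w k * cnj (b j k)) sums 0"
          by (rule orth[OF _ w[unfolded e]]) (intro holomorphic_intros holomorphic_B_disc V)
      qed
      then show "(\<lambda>k. of_nat k * w k * cnj (\<Sum>j<J. h j * b j k)) sums 0"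
        by (simp add: sum_distrib_left mult_ac)
    qed
  qed
  have pow: "dirichlet_integral (\<lambda>z. B z ^ J * x) = ennreal (pi * N * (real J * (norm x)\<^sup>2))" for J x
  proof -
    have "disc_series (\<lambda>k. b J k * x) (\<lambda>z. B z ^ J * x)"
      unfolding disc_series_def
    proof
      fix z :: complex assume "z \<in> ball 0 1"
      then have "(\<lambda>k. b J k * z ^ k * x) sums (B z ^ J * x)"
        by (intro sums_mult2 disc_seriesD[OF b]) simp
      then show "(\<lambda>k. b J k * x * z ^ k) sums (B z ^ J * x)" by (simp add: mult_ac)
    qed
    note D = dirichlet_integral_coeffs[OF this]
    have "(\<lambda>k. Re (of_nat k * b J k * cnj (b J k))) sums Re (of_nat J * of_nat N)"
      by (rule sums_Re[OF bb])
    then have "(\<lambda>k. real k * (norm (b J k))\<^sup>2) sums (real J * real N)"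
      by (simp add: mult.assoc complex_norm_square[symmetric])
    from sums_mult[OF this, of "pi * (norm x)\<^sup>2"]
    have "(\<lambda>k. pi * real k * (norm (b J k * x))\<^sup>2) sums (pi * N * (real J * (norm x)\<^sup>2))"
      by (simp add: norm_mult power_mult_distrib mult_ac)
    then show ?thesis unfolding D by (subst sums_unique[symmetric]) (auto simp: sums_ennreal)
  qed
  have poly: "dirichlet_integral (\<lambda>z. \<Sum>j<J. h j * B z ^ j) = ennreal (pi * N * (\<Sum>j<J. real j * (norm (h j))\<^sup>2))" for J
  proof (induction J)
    case 0
    show ?case by (simp add: dirichlet_integral_def)
  next
    case (Suc J)
    have "dirichlet_integral (\<lambda>z. \<Sum>j<Suc J. h j * B z ^ j)
       = dirichlet_integral (\<lambda>z. (\<Sum>j<J. h j * B z ^ j) + B z ^ J * h J)"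
      by (simp add: mult.commute)
    also have "\<dots> = dirichlet_integral (\<lambda>z. \<Sum>j<J. h j * B z ^ j) + dirichlet_integral (\<lambda>z. B z ^ J * h J)"
      by (rule split) (auto simp: Suc.IH)
    also have "\<dots> = ennreal (pi * N * (\<Sum>j<Suc J. real j * (norm (h j))\<^sup>2))"
      unfolding Suc.IH pow by (subst ennreal_plus[symmetric]) (auto simp: distrib_left sum_nonneg)
    finally show ?case .
  qed
  show ?poly by (rule poly)
  show ?split using split[OF _ V] unfolding poly by simp
qed

text \<open>Geometrically, \<open>B\<close> covers the disc \<open>N\<close> times. Here the lower
  bound discards the remainder after each polynomial section, and the upper bound follows from
  Fatou's lemma applied to the sections; neither half needs \<open>dirichlet_integral h\<close> to
  be finite.\<close>

theorem dirichlet_integral_compose: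
  assumes hol: "h holomorphic_on ball 0 1"
  shows "dirichlet_integral (\<lambda>z. h (B z)) = ennreal N * dirichlet_integral h"
proof -
  obtain x where x: "disc_series x h" using hol by (rule holomorphic_imp_disc_series)
  have B: "norm (B z) < 1" if "z \<in> ball 0 1" for z using norm_B_less_1 that by simp
  have D: "ennreal N * dirichlet_integral h = (\<Sum>j. ennreal (pi * N * (real j * (norm (x j))\<^sup>2)))"
    unfolding dirichlet_integral_coeffs[OF x]
    by (simp add: mult_ac flip: ennreal_suminf_cmult ennreal_mult')
  have partial: "(\<Sum>j<J. ennreal (pi * N * (real j * (norm (x j))\<^sup>2))) = ennreal (pi * N * (\<Sum>j<J. real j * (norm (x j))\<^sup>2))" for J
    by (subst sum_ennreal) (auto simp: sum_distrib_left)
  show ?thesis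
  proof (rule antisym)
    show "ennreal N * dirichlet_integral h \<le> dirichlet_integral (\<lambda>z. h (B z))"
      unfolding D
    proof (rule suminf_le_const)
      fix J
      \<comment> \<open>The Taylor tail of \<open>h\<close> divided by the \<open>J\<close>-th
        power. Its convergence is obtained by dividing by \<open>z ^ J\<close>, hence the separate
        case \<open>z = 0\<close>.\<close>
      define r where "r z = (\<Sum>j. x (j + J) * z ^ j)" for z
      have sm: "summable (\<lambda>j. x (j + J) * z ^ j)" if "norm z < 1" for z
      proof (cases "z = 0")
        case False
        have "summable (\<lambda>j. x (j + J) * z ^ (j + J))"
          using disc_seriesD[OF x that] by (intro summable_ignore_initial_segment) (simp add: sums_iff)
        then have "summable (\<lambda>j. x (j + J) * z ^ (j + J) * (1 / z ^ J))" by (rule summable_mult2)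
        then show ?thesis using False by (simp add: power_add)
      qed (simp add: summable_zero_power')
      then have r: "disc_series (\<lambda>j. x (j + J)) r"
        by (auto simp: disc_series_def r_def)
      have h_split: "h w = (\<Sum>j<J. x j * w ^ j) + w ^ J * r w" if w: "norm w < 1" for w
      proof -
        have "h w = (\<Sum>j. x (j + J) * w ^ (j + J)) + (\<Sum>j<J. x j * w ^ j)"
          using disc_seriesD[OF x w] suminf_split_initial_segment[of "\<lambda>j. x j * w ^ j" J] by (simp add: sums_iff)
        also have "(\<Sum>j. x (j + J) * w ^ (j + J)) = (\<Sum>j. w ^ J * (x (j + J) * w ^ j))"
          by (simp add: power_add mult_ac)
        also have "\<dots> = w ^ J * r w" unfolding r_def by (rule suminf_mult[OF sm[OF w]])
        finally show ?thesis by simp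
      qed
      have V: "(\<lambda>z. r (B z)) holomorphic_on ball 0 1"
        using holomorphic_on_compose_gen[OF holomorphic_B_disc disc_series_holomorphic[OF r]] B
        by (simp add: o_def image_subset_iff)
      have "dirichlet_integral (\<lambda>z. h (B z)) = dirichlet_integral (\<lambda>z. (\<Sum>j<J. x j * B z ^ j) + B z ^ J * r (B z))"
        by (rule dirichlet_integral_cong) (use h_split B in simp)
      also have "\<dots> \<ge> ennreal (pi * N * (\<Sum>j<J. real j * (norm (x j))\<^sup>2))"
        unfolding dirichlet_integral_polynomial_compose_split(2)[OF V] by simp
      finally show "(\<Sum>j<J. ennreal (pi * N * (real j * (norm (x j))\<^sup>2))) \<le> dirichlet_integral (\<lambda>z. h (B z))"
        unfolding partial .
    qed (rule summableI)
    show "dirichlet_integral (\<lambda>z. h (B z)) \<le> ennreal N * dirichlet_integral h"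
    proof (rule dirichlet_integral_le_of_tendsto)
      fix J
      show "(\<lambda>z. \<Sum>j<J. x j * B z ^ j) holomorphic_on ball 0 1"
        by (intro holomorphic_intros holomorphic_B_disc)
      have "dirichlet_integral (\<lambda>z. \<Sum>j<J. x j * B z ^ j) = (\<Sum>j<J. ennreal (pi * N * (real j * (norm (x j))\<^sup>2)))"
        unfolding partial by (rule dirichlet_integral_polynomial_compose_split(1)[of "\<lambda>_. 0"]) simp
      also have "\<dots> \<le> ennreal N * dirichlet_integral h"
        unfolding D by (rule sum_le_suminf) (auto intro: summableI)
      finally show "dirichlet_integral (\<lambda>z. \<Sum>j<J. x j * B z ^ j) \<le> ennreal N * dirichlet_integral h" .
    next
      fix z :: complex assume z: "z \<in> ball 0 1"
      have dB: "(B has_field_derivative deriv B z) (at z)"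
        by (rule holomorphic_derivI[OF holomorphic_B_disc open_ball z])
      have "(h has_field_derivative deriv h (B z)) (at (B z))"
        using holomorphic_derivI[OF hol open_ball] B[OF z] by simp
      from DERIV_chain2[OF this dB]
      have lim: "deriv (\<lambda>z. h (B z)) z = deriv h (B z) * deriv B z" by (rule DERIV_imp_deriv)
      have "((\<lambda>z. \<Sum>j<J. x j * B z ^ j) has_field_derivative (\<Sum>j<J. x j * (of_nat j * (deriv B z * B z ^ (j - 1))))) (at z)" for J
        by (intro DERIV_sum DERIV_cmult) (use DERIV_power[OF dB] in simp)
      then have "deriv (\<lambda>z. \<Sum>j<J. x j * B z ^ j) z = (\<Sum>j<J. x j * (of_nat j * (deriv B z * B z ^ (j - 1))))" for J
        by (rule DERIV_imp_deriv)
      then have eq: "deriv (\<lambda>z. \<Sum>j<J. x j * B z ^ j) z = (\<Sum>j<J. of_nat j * x j * B z ^ (j - 1)) * deriv B z" for J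
        by (simp add: sum_distrib_left mult_ac)
      have "(\<lambda>j. of_nat (Suc j) * x (Suc j) * B z ^ j) sums deriv h (B z)"
        by (rule disc_seriesD[OF disc_series_deriv[OF x] B[OF z]])
      then have "(\<lambda>j. of_nat j * x j * B z ^ (j - 1)) sums deriv h (B z)"
        using sums_Suc_iff[of "\<lambda>j. of_nat j * x j * B z ^ (j - 1)"] by simp
      then have "(\<lambda>J. (\<Sum>j<J. of_nat j * x j * B z ^ (j - 1)) * deriv B z) \<longlonglongrightarrow> deriv h (B z) * deriv B z"
        unfolding sums_def by (rule tendsto_mult_right)
      then show "(\<lambda>J. deriv (\<lambda>z. \<Sum>j<J. x j * B z ^ j) z) \<longlonglongrightarrow> deriv (\<lambda>z. h (B z)) z"
        unfolding eq lim .
    qed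
  qed
qed

end

subsection \<open>Subordination and contraction\<close>

lemma hardy2_norm_sq_mult_le:
  assumes "\<And>z. z \<in> ball 0 1 \<Longrightarrow> norm (f z) \<le> 1"
  shows "hardy2_norm_sq (\<lambda>z. f z * g z) \<le> hardy2_norm_sq g"
  unfolding hardy2_norm_sq_def
proof (rule SUP_mono, rule bexI)
  fix r :: real assume r: "r \<in> {0<..<1}"
  then have "norm (f (of_real r * cis t)) \<le> 1" for t
    by (intro assms) (simp add: norm_mult)
  then have "(norm (f (of_real r * cis t) * g (of_real r * cis t)))\<^sup>2 \<le> (norm (g (of_real r * cis t)))\<^sup>2" for t
    unfolding norm_mult by (intro power_mono mult_left_le_one_le) auto
  then show "(\<integral>\<^sup>+t\<in>{0..2*pi}. ennreal ((norm (f (of_real r * cis t) * g (of_real r * cis t)))\<^sup>2 / (2 * pi)) \<partial>lborel)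
     \<le> (\<integral>\<^sup>+t\<in>{0..2*pi}. ennreal ((norm (g (of_real r * cis t)))\<^sup>2 / (2 * pi)) \<partial>lborel)"
    by (intro nn_integral_mono mult_right_mono ennreal_leI divide_right_mono) auto
qed

text \<open>Constants are orthogonal to functions vanishing at 0. In Littlewood's induction
  \<open>g\<close> is a multiple of \<open>f\<close>, and this is where \<open>f 0 = 0\<close>
  enters.\<close>

lemma hardy2_norm_sq_add_const:
  assumes g: "g holomorphic_on ball 0 1" and g0: "g 0 = 0"
  shows "hardy2_norm_sq (\<lambda>z. x + g z) = ennreal ((norm x)\<^sup>2) + hardy2_norm_sq g"
proof -
  obtain c where c: "disc_series c g" using g by (rule holomorphic_imp_disc_series)
  have c0: "c 0 = 0" using disc_series_0[OF c] g0 by simp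
  have "disc_series (\<lambda>k. if k = 0 then x else 0) (\<lambda>_. x)"
    unfolding disc_series_def
  proof
    fix z :: complex
    have "(\<lambda>k. if k = 0 then x * z ^ k else 0) sums (x * z ^ 0)" by (rule sums_single)
    then show "(\<lambda>k. (if k = 0 then x else 0) * z ^ k) sums x"
      by (simp add: if_distrib[of "\<lambda>u. u * _"] cong: if_cong)
  qed
  from disc_series_add[OF this c]
  have d: "disc_series (\<lambda>k. (if k = 0 then x else 0) + c k) (\<lambda>z. x + g z)" .
  have "(\<Sum>k. ennreal ((norm ((if k = 0 then x else 0) + c k))\<^sup>2))
      = ennreal ((norm x)\<^sup>2) + (\<Sum>k. ((\<lambda>k. ennreal ((norm ((if k = 0 then x else 0) + c k))\<^sup>2)) (0 := 0)) k)"
    by (subst suminf_ennreal_remove[of _ 0]) (simp add: c0)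
  also have "(\<Sum>k. ((\<lambda>k. ennreal ((norm ((if k = 0 then x else 0) + c k))\<^sup>2)) (0 := 0)) k) = (\<Sum>k. ennreal ((norm (c k))\<^sup>2))"
    by (intro suminf_cong) (auto simp: c0)
  finally show ?thesis
    unfolding hardy2_norm_sq_coeffs[OF d] hardy2_norm_sq_coeffs[OF c] .
qed

text \<open>Horner's scheme: a polynomial in \<open>f\<close> is \<open>x 0 + f * P\<close> with
  \<open>P\<close> of lower degree. The two summands are orthogonal and multiplication by
  \<open>f\<close> is a contraction, so induction over all coefficient sequences bounds polynomials;
  Fatou's lemma passes to \<open>h\<close>.\<close>

theorem littlewood_subordination:
  assumes f: "f holomorphic_on ball 0 1" and f_disc: "\<And>z. z \<in> ball 0 1 \<Longrightarrow> f z \<in> ball 0 1" and f0: "f 0 = 0"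
    and h: "h holomorphic_on ball 0 1"
  shows "hardy2_norm_sq (\<lambda>z. h (f z)) \<le> hardy2_norm_sq h"
proof -
  obtain x where x: "disc_series x h" using h by (rule holomorphic_imp_disc_series)
  have poly: "hardy2_norm_sq (\<lambda>z. \<Sum>j<J. x j * f z ^ j) \<le> (\<Sum>j<J. ennreal ((norm (x j))\<^sup>2))" for J and x :: "nat \<Rightarrow> complex"
  proof (induction J arbitrary: x)
    case 0
    show ?case by (simp add: hardy2_norm_sq_def)
  next
    case (Suc J)
    define P where "P z = (\<Sum>j<J. x (Suc j) * f z ^ j)" for z
    have P: "P holomorphic_on ball 0 1" unfolding P_def by (intro holomorphic_intros f)
    have "(\<Sum>j<Suc J. x j * f z ^ j) = x 0 + f z * P z" for z
      unfolding sum.lessThan_Suc_shift P_def by (simp add: sum_distrib_left mult_ac)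
    then have "hardy2_norm_sq (\<lambda>z. \<Sum>j<Suc J. x j * f z ^ j) = hardy2_norm_sq (\<lambda>z. x 0 + f z * P z)"
      by (simp only:)
    also have "\<dots> = ennreal ((norm (x 0))\<^sup>2) + hardy2_norm_sq (\<lambda>z. f z * P z)"
      by (rule hardy2_norm_sq_add_const) (use f P f0 in \<open>auto intro!: holomorphic_intros\<close>)
    also have "hardy2_norm_sq (\<lambda>z. f z * P z) \<le> hardy2_norm_sq P"
      by (rule hardy2_norm_sq_mult_le) (use f_disc in \<open>auto intro: less_imp_le\<close>)
    also have "hardy2_norm_sq P \<le> (\<Sum>j<J. ennreal ((norm (x (Suc j)))\<^sup>2))"
      unfolding P_def by (rule Suc.IH)
    finally show ?case
      unfolding sum.lessThan_Suc_shift by (simp add: add_left_mono)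
  qed
  show ?thesis
  proof (rule hardy2_norm_sq_le_of_tendsto)
    fix J
    show "(\<lambda>z. \<Sum>j<J. x j * f z ^ j) holomorphic_on ball 0 1" by (intro holomorphic_intros f)
    show "hardy2_norm_sq (\<lambda>z. \<Sum>j<J. x j * f z ^ j) \<le> hardy2_norm_sq h"
      unfolding hardy2_norm_sq_coeffs[OF x]
      by (rule order_trans[OF poly]) (rule sum_le_suminf, auto intro: summableI)
  next
    fix z :: complex assume "z \<in> ball 0 1"
    then have "norm (f z) < 1" using f_disc by simp
    from disc_seriesD[OF x this]
    show "(\<lambda>J. \<Sum>j<J. x j * f z ^ j) \<longlonglongrightarrow> h (f z)" by (simp add: sums_def)
  qed
qed

locale blaschke_origin = blaschke +
  assumes N_ge_2: "2 \<le> N" and B_0: "B 0 = 0"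
begin

lemma B_disc: "z \<in> ball 0 1 \<Longrightarrow> B z \<in> ball 0 1"
  using norm_B_less_1 by simp

text \<open>A linear \<open>B\<close> would have Dirichlet integral \<open>\<pi>\<close> instead of \<open>\<pi> N\<close>.\<close>

lemma B_not_linear:
  assumes lin: "\<And>z. norm z < 1 \<Longrightarrow> B z = \<beta> * z" and \<beta>: "norm \<beta> = 1"
  shows False
proof -
  have D: "dirichlet_integral (\<lambda>z. x * z) = ennreal (pi * (norm x)\<^sup>2)" for x
  proof -
    have "(deriv ((*) x)) z = x" for z by (intro DERIV_imp_deriv) (auto intro!: derivative_eq_intros)
    then have "dirichlet_integral (\<lambda>z. x * z) = (\<integral>\<^sup>+z\<in>ball 0 1. ennreal ((norm x)\<^sup>2) \<partial>(lborel :: complex measure))"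
      by (simp add: dirichlet_integral_def)
    also have "\<dots> = ennreal ((norm x)\<^sup>2) * emeasure lborel (ball (0::complex) 1)"
      by (rule nn_integral_cmult_indicator) simp
    also have "emeasure lborel (ball (0::complex) 1) = ennreal pi"
      by (simp add: emeasure_ball unit_ball_vol_2)
    finally show ?thesis by (simp add: mult.commute flip: ennreal_mult)
  qed
  have "dirichlet_integral (\<lambda>z. 1 * B z) = ennreal N * dirichlet_integral (\<lambda>z. 1 * z)"
    by (rule dirichlet_integral_compose) (intro holomorphic_intros)
  moreover have "dirichlet_integral (\<lambda>z. 1 * B z) = dirichlet_integral (\<lambda>z. \<beta> * z)"
    by (rule dirichlet_integral_cong) (use lin in simp)
  ultimately have "ennreal pi = ennreal (real N * pi)"
    unfolding D \<beta> by (simp add: ennreal_mult)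
  then show False using N_ge_2 by simp
qed

text \<open>Equality in the Schwarz lemma at a nonzero point would make \<open>B\<close> a rotation,
  contrary to \<open>B_not_linear\<close>.\<close>

lemma norm_B_less:
  assumes "norm z < 1" "z \<noteq> 0"
  shows "norm (B z) < norm z"
proof -
  note S = Schwarz_Lemma[OF holomorphic_B_disc B_0 norm_B_less_1 assms(1)]
  have "norm (B z) \<noteq> norm z"
  proof
    assume "norm (B z) = norm z"
    with assms have "\<exists>z. norm z < 1 \<and> z \<noteq> 0 \<and> norm (B z) = norm z" by blast
    from S(3)[OF _ disjI1[OF this]] obtain \<beta> where "\<forall>z. norm z < 1 \<longrightarrow> B z = \<beta> * z" "norm \<beta> = 1"
      by blast
    then show False using B_not_linear[of \<beta>] by simp
  qed
  with S(1) show ?thesis by simp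
qed

text \<open>The equality case of the Schwarz lemma at the origin. Strictness makes the Hardy
  constant \<open>1 / (1 - norm (deriv B 0))^2\<close> meaningful.\<close>

lemma norm_deriv_B_0: "norm (deriv B 0) < 1"
proof -
  note S = Schwarz_Lemma[OF holomorphic_B_disc B_0 norm_B_less_1, of 0]
  have "norm (deriv B 0) \<noteq> 1"
  proof
    assume "norm (deriv B 0) = 1"
    with S(3) obtain \<beta> where "\<forall>z. norm z < 1 \<longrightarrow> B z = \<beta> * z" "norm \<beta> = 1"
      by (metis norm_zero zero_less_one)
    then show False using B_not_linear[of \<beta>] by simp
  qed
  with S(2) show ?thesis by simp
qed

text \<open>The quotient \<open>B z / z\<close>, extended by \<open>deriv B 0\<close>, is
  holomorphic with modulus below 1 throughout the disc; its maximum over a compact smaller disc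
  serves as \<open>q\<close>.\<close>

lemma B_contraction:
  assumes "r < 1"
  obtains q where "0 \<le> q" "q < 1" "\<And>z. norm z \<le> r \<Longrightarrow> norm (B z) \<le> q * norm z"
proof (cases "r \<ge> 0")
  case True
  define g where "g z = (if z = 0 then deriv B 0 else (B z - B 0) / (z - 0))" for z
  have "g holomorphic_on ball 0 1"
    unfolding g_def by (rule pole_lemma_open[OF holomorphic_B_disc open_ball])
  then have cont: "continuous_on (cball 0 r) (\<lambda>z. norm (g z))"
    by (intro continuous_intros holomorphic_on_imp_continuous_on)
      (rule holomorphic_on_subset, use assms in auto)
  have "cball (0::complex) r \<noteq> {}" using True by simp
  from continuous_attains_sup[OF compact_cball this cont]
  obtain z0 where z0: "z0 \<in> cball 0 r" and max: "\<And>z. z \<in> cball 0 r \<Longrightarrow> norm (g z) \<le> norm (g z0)"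
    by blast
  show ?thesis
  proof (rule that)
    show "norm (g z0) < 1"
      using z0 assms norm_deriv_B_0 norm_B_less[of z0]
      by (auto simp: g_def B_0 norm_divide divide_less_eq)
    show "norm (B z) \<le> norm (g z0) * norm z" if "norm z \<le> r" for z
    proof (cases "z = 0")
      case False
      then have "norm (B z) = norm (g z) * norm z" by (simp add: g_def B_0 norm_divide)
      also have "\<dots> \<le> norm (g z0) * norm z" using max[of z] that by (intro mult_right_mono) auto
      finally show ?thesis .
    qed (simp add: B_0)
  qed simp
next
  case False
  then have "\<not> norm z \<le> r" for z :: complex using norm_ge_zero[of z] by linarith
  then show ?thesis by (intro that[of 0]) auto
qed

end

subsection \<open>Series of iterates\<close>

context blaschke_origin
begin

lemma iterate_disc: "z \<in> ball 0 1 \<Longrightarrow> (B ^^ n) z \<in> ball 0 1"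
  by (induction n) (use B_disc in auto)

lemma holomorphic_iterate: "(B ^^ n) holomorphic_on ball 0 1"
proof (induction n)
  case 0
  show ?case by (simp add: id_def holomorphic_on_ident)
next
  case (Suc n)
  have "B \<circ> (B ^^ n) holomorphic_on ball 0 1"
    by (rule holomorphic_on_compose_gen[OF Suc holomorphic_B_disc]) (use iterate_disc in blast)
  then show ?case by (simp add: o_def)
qed

text \<open>The sum starts at the identity, unlike the series of the theorem. With this convention
  removing \<open>a 0\<close> and shifting the coefficients gives a series of the same kind
  evaluated at \<open>B z\<close>, which closes the recursion; the theorem uses it with coefficient
  0 at index 0.\<close>

definition iterate_series :: "(nat \<Rightarrow> complex) \<Rightarrow> complex \<Rightarrow> complex" where
  "iterate_series a z = (\<Sum>n. a n * (B ^^ n) z)"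

text \<open>The disc \<open>norm z \<le> r\<close> is mapped into itself, so one contraction factor
  serves at every step. Bounded coefficients then already give locally uniform convergence of the
  series.\<close>

lemma iterate_geometric:
  assumes "r < 1"
  obtains q where "0 \<le> q" "q < 1" "\<And>n z. norm z \<le> r \<Longrightarrow> norm ((B ^^ n) z) \<le> q ^ n"
proof -
  obtain q where q: "0 \<le> q" "q < 1" and c: "\<And>z. norm z \<le> r \<Longrightarrow> norm (B z) \<le> q * norm z"
    using B_contraction[OF assms] by blast
  have "norm ((B ^^ n) z) \<le> q ^ n * norm z" if z: "norm z \<le> r" for n z
  proof (induction n)
    case (Suc n)
    have "q ^ n * norm z \<le> 1 * norm z"
      by (intro mult_right_mono power_le_one) (use q in auto)
    with Suc z have "norm ((B ^^ n) z) \<le> r" by linarith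
    from c[OF this] have "norm ((B ^^ Suc n) z) \<le> q * norm ((B ^^ n) z)" by simp
    also have "\<dots> \<le> q * (q ^ n * norm z)" using Suc q by (intro mult_left_mono) auto
    finally show ?case by simp
  qed simp
  moreover have "q ^ n * norm z \<le> q ^ n" if "norm z \<le> r" for n and z :: complex
    using that assms q by (intro mult_left_le) auto
  ultimately have "norm ((B ^^ n) z) \<le> q ^ n" if "norm z \<le> r" for n z
    using that order_trans by blast
  then show thesis using q that by blast
qed

lemma iterate_series_uniform_limit:
  assumes a: "bounded (range a)" and r: "r < 1"
  shows "uniform_limit (cball 0 r) (\<lambda>M z. \<Sum>n<M. a n * (B ^^ n) z) (iterate_series a) sequentially"
proof -
  obtain q where q: "0 \<le> q" "q < 1" and it: "\<And>n z. norm z \<le> r \<Longrightarrow> norm ((B ^^ n) z) \<le> q ^ n"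
    using iterate_geometric[OF r] by blast
  obtain K where K: "\<And>n. norm (a n) \<le> K"
    using a by (auto simp: bounded_iff)
  then have K0: "0 \<le> K" using norm_ge_zero order_trans by blast
  show ?thesis
    unfolding iterate_series_def[abs_def]
  proof (rule Weierstrass_m_test)
    show "norm (a n * (B ^^ n) z) \<le> K * q ^ n" if "z \<in> cball 0 r" for n z
      unfolding norm_mult using that K it[of z n] K0 by (intro mult_mono) auto
    show "summable (\<lambda>n. K * q ^ n)"
      by (intro summable_mult summable_geometric) (use q in simp)
  qed
qed

lemma iterate_series_sums:
  assumes a: "bounded (range a)" and z: "z \<in> ball 0 1"
  shows "(\<lambda>n. a n * (B ^^ n) z) sums iterate_series a z"
  using tendsto_uniform_limitI[OF iterate_series_uniform_limit[OF a, of "norm z"], of z] z by (simp add: sums_def)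

lemma iterate_series_uniform_limit_local:
  assumes a: "bounded (range a)" and z: "z \<in> ball 0 1"
  shows "\<exists>d>0. cball z d \<subseteq> ball 0 1 \<and> uniform_limit (cball z d) (\<lambda>M z. \<Sum>n<M. a n * (B ^^ n) z) (iterate_series a) sequentially"
proof -
  define d where "d = (1 - norm z) / 2"
  have d: "d > 0" "norm z + d < 1" using z by (auto simp: d_def field_simps)
  have sub: "cball z d \<subseteq> cball 0 (norm z + d)"
    by (auto simp: dist_norm) (metis add.commute add_le_cancel_left dual_order.trans norm_minus_commute norm_triangle_sub)
  then have "cball z d \<subseteq> ball 0 1" using d by force
  moreover have "uniform_limit (cball z d) (\<lambda>M z. \<Sum>n<M. a n * (B ^^ n) z) (iterate_series a) sequentially"
    by (rule uniform_limit_on_subset[OF iterate_series_uniform_limit[OF a d(2)] sub])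
  ultimately show ?thesis using d by blast
qed

lemma holomorphic_partial: "(\<lambda>z. \<Sum>n<M. a n * (B ^^ n) z) holomorphic_on ball 0 1"
  by (intro holomorphic_on_sum holomorphic_on_mult holomorphic_on_const holomorphic_iterate)

lemma holomorphic_iterate_series:
  assumes a: "bounded (range a)"
  shows "iterate_series a holomorphic_on ball 0 1"
  by (rule holomorphic_uniform_sequence[where f = "\<lambda>M z. \<Sum>n<M. a n * (B ^^ n) z", OF open_ball holomorphic_partial])
    (use iterate_series_uniform_limit_local[OF a] in blast)

lemma deriv_partial_tendsto:
  assumes a: "bounded (range a)" and z: "z \<in> ball 0 1"
  shows "(\<lambda>M. deriv (\<lambda>z. \<Sum>n<M. a n * (B ^^ n) z) z) \<longlonglongrightarrow> deriv (iterate_series a) z"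
proof -
  have "((\<lambda>z. \<Sum>n<M. a n * (B ^^ n) z) has_field_derivative deriv (\<lambda>z. \<Sum>n<M. a n * (B ^^ n) z) w) (at w)"
    if "w \<in> ball 0 1" for M w
    by (rule holomorphic_derivI[OF holomorphic_partial open_ball that])
  from has_complex_derivative_uniform_sequence[OF open_ball this iterate_series_uniform_limit_local[OF a]]
  obtain g' where "(iterate_series a has_field_derivative g') (at z)"
    and "(\<lambda>M. deriv (\<lambda>z. \<Sum>n<M. a n * (B ^^ n) z) z) \<longlonglongrightarrow> g'"
    using z by blast
  then show ?thesis by (simp add: DERIV_imp_deriv)
qed

lemma iterate_series_shift:
  assumes a: "bounded (range a)" and z: "z \<in> ball 0 1"
  shows "iterate_series a z = a 0 * z + iterate_series (\<lambda>n. a (Suc n)) (B z)"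
proof -
  have "iterate_series a z = (\<Sum>n. a (Suc n) * (B ^^ Suc n) z) + a 0 * (B ^^ 0) z"
    unfolding iterate_series_def by (subst suminf_split_head) (use iterate_series_sums[OF a z] in \<open>auto simp: sums_iff\<close>)
  \<comment> \<open>The innermost application of \<open>B\<close> is peeled off, since the norm
    results concern composition with \<open>B\<close> on the right.\<close>
  then show ?thesis by (simp only: iterate_series_def funpow_Suc_right o_apply) simp
qed

lemma bounded_range_Suc: "bounded (range a) \<Longrightarrow> bounded (range (\<lambda>n. a (Suc n)))"
  by (erule bounded_subset) auto

lemma holomorphic_iterate_series_compose:
  assumes a: "bounded (range a)"
  shows "(\<lambda>z. iterate_series a (B z)) holomorphic_on ball 0 1"
  using holomorphic_on_compose_gen[OF holomorphic_B_disc holomorphic_iterate_series[OF a]] B_disc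
  by (simp add: o_def image_subset_iff)

lemma deriv_iterate_series_compose:
  assumes a: "bounded (range a)"
  shows "deriv (\<lambda>z. iterate_series a (B z)) 0 = deriv B 0 * deriv (iterate_series a) 0"
proof (rule DERIV_imp_deriv)
  have dB: "(B has_field_derivative deriv B 0) (at 0)"
    by (rule holomorphic_derivI[OF holomorphic_B_disc open_ball]) simp
  have "(iterate_series a has_field_derivative deriv (iterate_series a) 0) (at (B 0))"
    unfolding B_0 by (rule holomorphic_derivI[OF holomorphic_iterate_series[OF a] open_ball]) simp
  from DERIV_chain2[OF this dB]
  show "((\<lambda>z. iterate_series a (B z)) has_field_derivative deriv B 0 * deriv (iterate_series a) 0) (at 0)" by (simp add: mult.commute)
qed

lemma deriv_iterate_series_shift:
  assumes a: "bounded (range a)"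
  shows "deriv (iterate_series a) 0 = a 0 + deriv B 0 * deriv (iterate_series (\<lambda>n. a (Suc n))) 0"
proof (rule DERIV_imp_deriv)
  have "((\<lambda>z. iterate_series (\<lambda>n. a (Suc n)) (B z)) has_field_derivative deriv B 0 * deriv (iterate_series (\<lambda>n. a (Suc n))) 0) (at 0)"
    using holomorphic_derivI[OF holomorphic_iterate_series_compose[OF bounded_range_Suc[OF a]] open_ball, of 0]
      deriv_iterate_series_compose[OF bounded_range_Suc[OF a]] by simp
  then have "((\<lambda>z. a 0 * z + iterate_series (\<lambda>n. a (Suc n)) (B z)) has_field_derivative
      a 0 + deriv B 0 * deriv (iterate_series (\<lambda>n. a (Suc n))) 0) (at 0)"
    by (auto intro!: derivative_eq_intros)
  then show "(iterate_series a has_field_derivative a 0 + deriv B 0 * deriv (iterate_series (\<lambda>n. a (Suc n))) 0) (at 0)"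
    by (rule has_field_derivative_transform_within_open[OF _ open_ball[of 0 1]])
      (use iterate_series_shift[OF a] in auto)
qed

lemma iterate_series_nonlinear_part:
  assumes a: "bounded (range a)" and z: "z \<in> ball 0 1"
  shows "iterate_series a z - deriv (iterate_series a) 0 * z
     = iterate_series (\<lambda>n. a (Suc n)) (B z) - deriv (\<lambda>z. iterate_series (\<lambda>n. a (Suc n)) (B z)) 0 * z"
  unfolding deriv_iterate_series_shift[OF a] deriv_iterate_series_compose[OF bounded_range_Suc[OF a]] iterate_series_shift[OF a z] by (simp add: algebra_simps)

text \<open>Splitting off the linear parts of the series and of the composition leaves the common
  remainder \<open>?T\<close>. The term with \<open>deriv B 0\<close> stays on the left because the
  integrals may be infinite and cannot be subtracted.\<close>

lemma dirichlet_iterate_series_step: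
  assumes a: "bounded (range a)"
  defines "a' \<equiv> \<lambda>n. a (Suc n)"
  shows "dirichlet_integral (iterate_series a) + ennreal (pi * (norm (deriv B 0 * deriv (iterate_series a') 0))\<^sup>2)
       = ennreal (pi * (norm (deriv (iterate_series a) 0))\<^sup>2) + ennreal N * dirichlet_integral (iterate_series a')"
proof -
  have a': "bounded (range a')" unfolding a'_def by (rule bounded_range_Suc[OF a])
  let ?T = "dirichlet_integral (\<lambda>z. iterate_series a z - deriv (iterate_series a) 0 * z)"
  have "ennreal N * dirichlet_integral (iterate_series a') = dirichlet_integral (\<lambda>z. iterate_series a' (B z))"
    by (rule dirichlet_integral_compose[symmetric, OF holomorphic_iterate_series[OF a']])
  also have "\<dots> = ennreal (pi * (norm (deriv B 0 * deriv (iterate_series a') 0))\<^sup>2)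
      + dirichlet_integral (\<lambda>z. iterate_series a' (B z) - deriv (\<lambda>z. iterate_series a' (B z)) 0 * z)"
    using dirichlet_integral_split_linear[OF holomorphic_iterate_series_compose[OF a']] unfolding deriv_iterate_series_compose[OF a'] .
  also have "dirichlet_integral (\<lambda>z. iterate_series a' (B z) - deriv (\<lambda>z. iterate_series a' (B z)) 0 * z) = ?T"
    by (rule dirichlet_integral_cong) (use iterate_series_nonlinear_part[OF a] in \<open>simp add: a'_def\<close>)
  finally have 1: "ennreal N * dirichlet_integral (iterate_series a') = ennreal (pi * (norm (deriv B 0 * deriv (iterate_series a') 0))\<^sup>2) + ?T" .
  show ?thesis
    unfolding 1 dirichlet_integral_split_linear[OF holomorphic_iterate_series[OF a]] by (simp add: ac_simps)
qed

text \<open>Only an inequality: the linear part of the composition is discarded before Littlewood's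
  bound is applied.\<close>

lemma hardy_iterate_series_step:
  assumes a: "bounded (range a)"
  defines "a' \<equiv> \<lambda>n. a (Suc n)"
  shows "hardy2_norm_sq (iterate_series a) \<le> ennreal ((norm (deriv (iterate_series a) 0))\<^sup>2) + hardy2_norm_sq (iterate_series a')"
proof -
  have a': "bounded (range a')" unfolding a'_def by (rule bounded_range_Suc[OF a])
  have "hardy2_norm_sq (\<lambda>z. iterate_series a z - deriv (iterate_series a) 0 * z)
      = hardy2_norm_sq (\<lambda>z. iterate_series a' (B z) - deriv (\<lambda>z. iterate_series a' (B z)) 0 * z)"
    by (rule hardy2_norm_sq_cong) (use iterate_series_nonlinear_part[OF a] in \<open>simp add: a'_def\<close>)
  also have "\<dots> \<le> hardy2_norm_sq (\<lambda>z. iterate_series a' (B z))"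
    unfolding hardy2_norm_sq_split_linear[OF holomorphic_iterate_series_compose[OF a']] by simp
  also have "\<dots> \<le> hardy2_norm_sq (iterate_series a')"
    by (rule littlewood_subordination[OF holomorphic_B_disc B_disc B_0 holomorphic_iterate_series[OF a']])
  finally show ?thesis
    unfolding hardy2_norm_sq_split_linear[OF holomorphic_iterate_series[OF a]] by (rule add_left_mono)
qed

text \<open>The linear coefficient is carried along in the inductions: it absorbs the cross terms between
  \<open>a 0\<close> and the rest of the series. The constants \<open>3/4\<close>, \<open>1/8\<close>, and \<open>3\<close>, \<open>12\<close> in the upper bound,
  make the induction steps close for every \<open>N \<ge> 2\<close>.\<close>

lemma dirichlet_iterate_series_lower:
  assumes "bounded (range a)"
  shows "ennreal (3/4 * pi * (norm (deriv (iterate_series a) 0))\<^sup>2 + pi / 8 * (\<Sum>j<M. (norm (a j))\<^sup>2 * real N ^ j))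
     \<le> dirichlet_integral (iterate_series a)"
  using assms
proof (induction M arbitrary: a)
  case 0
  have "ennreal (3/4 * pi * (norm (deriv (iterate_series a) 0))\<^sup>2 + pi / 8 * (\<Sum>j<0. (norm (a j))\<^sup>2 * real N ^ j))
      \<le> ennreal (pi * (norm (deriv (iterate_series a) 0))\<^sup>2)"
    by (intro ennreal_leI) simp
  also have "\<dots> \<le> dirichlet_integral (iterate_series a)"
    unfolding dirichlet_integral_split_linear[OF holomorphic_iterate_series[OF 0]] by simp
  finally show ?case .
next
  case (Suc M)
  define a' where "a' = (\<lambda>n. a (Suc n))"
  define \<beta> \<beta>' where "\<beta> = deriv (iterate_series a) 0" and "\<beta>' = deriv (iterate_series a') 0"
  define T where "T = (\<Sum>j<M. (norm (a' j))\<^sup>2 * real N ^ j)"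
  have a': "bounded (range a')" unfolding a'_def by (rule bounded_range_Suc[OF Suc.prems])
  have step: "dirichlet_integral (iterate_series a) + ennreal (pi * (norm (deriv B 0 * \<beta>'))\<^sup>2)
      = ennreal (pi * (norm \<beta>)\<^sup>2) + ennreal N * dirichlet_integral (iterate_series a')"
    unfolding \<beta>_def \<beta>'_def a'_def by (rule dirichlet_iterate_series_step[OF Suc.prems])
  have \<beta>: "\<beta> = a 0 + deriv B 0 * \<beta>'"
    unfolding \<beta>_def \<beta>'_def a'_def by (rule deriv_iterate_series_shift[OF Suc.prems])
  have sum: "(\<Sum>j<Suc M. (norm (a j))\<^sup>2 * real N ^ j) = (norm (a 0))\<^sup>2 + N * T"
    unfolding sum.lessThan_Suc_shift T_def a'_def by (simp add: sum_distrib_left mult_ac)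
  have small: "norm (deriv B 0 * \<beta>') \<le> norm \<beta>'"
    using norm_deriv_B_0 by (simp add: norm_mult mult_left_le_one_le)
  then have small2: "(norm (deriv B 0 * \<beta>'))\<^sup>2 \<le> (norm \<beta>')\<^sup>2" by (intro power_mono) auto
  show ?case
  proof (cases "dirichlet_integral (iterate_series a)" rule: ennreal_cases)
    case (real d)
    have "ennreal (pi * (norm \<beta>)\<^sup>2) + ennreal N * dirichlet_integral (iterate_series a') \<noteq> top"
      unfolding step[symmetric] real by simp
    \<comment> \<open>As \<open>N > 0\<close>, finiteness passes from \<open>a\<close> to
      \<open>a'\<close>, and the recursion becomes an equation between real numbers. For an infinite
      integral the claim is trivial.\<close>
    then have "dirichlet_integral (iterate_series a') \<noteq> top"
      using N_ge_2 by (auto simp: ennreal_mult_top)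
    then obtain d' where d': "0 \<le> d'" "dirichlet_integral (iterate_series a') = ennreal d'"
      by (cases "dirichlet_integral (iterate_series a')" rule: ennreal_cases) auto
    have "ennreal (d + pi * (norm (deriv B 0 * \<beta>'))\<^sup>2) = ennreal (pi * (norm \<beta>)\<^sup>2 + N * d')"
      using step real d' by (simp add: ennreal_mult)
    then have eq: "d + pi * (norm (deriv B 0 * \<beta>'))\<^sup>2 = pi * (norm \<beta>)\<^sup>2 + N * d'"
      using real(1) d'(1) by (subst (asm) ennreal_inj) auto
    \<comment> \<open>The quarter of \<open>b\<close> left over covers the \<open>b\<close> part of
      \<open>\<alpha> / 8\<close>. What remains to check is \<open>3/4 * u \<ge> 5/4 * g\<close>,
      which follows from \<open>u \<ge> 2 * g\<close>, that is, from
      \<open>N \<ge> 2\<close>.\<close>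
    have arith: "3/4 * b + (\<alpha> + v) / 8 \<le> d"
      if "3/4 * u + v / 8 \<le> w" "2 * g \<le> u" "e \<le> g" "\<alpha> \<le> 2 * b + 2 * g" "d + e = b + w" "0 \<le> g"
      for b \<alpha> u v w g e :: real
      using that by (simp add: field_simps)
    have "3/4 * (pi * (norm \<beta>)\<^sup>2) + (pi * (norm (a 0))\<^sup>2 + N * (pi * T)) / 8 \<le> d"
    proof (rule arith[OF _ _ _ _ eq])
      have "3/4 * (pi * (norm \<beta>')\<^sup>2) + pi * T / 8 \<le> d'"
        using Suc.IH[OF a'] d' unfolding \<beta>'_def[symmetric] T_def[symmetric] by (simp add: ennreal_le_iff)
      then have "N * (3/4 * (pi * (norm \<beta>')\<^sup>2) + pi * T / 8) \<le> N * d'" by (intro mult_left_mono) auto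
      then show "3/4 * (N * (pi * (norm \<beta>')\<^sup>2)) + N * (pi * T) / 8 \<le> N * d'" by (simp add: algebra_simps)
      show "2 * (pi * (norm \<beta>')\<^sup>2) \<le> N * (pi * (norm \<beta>')\<^sup>2)"
        using N_ge_2 by (intro mult_right_mono) auto
      show "pi * (norm (deriv B 0 * \<beta>'))\<^sup>2 \<le> pi * (norm \<beta>')\<^sup>2" using small2 by simp
      have "norm (a 0) \<le> norm \<beta> + norm \<beta>'"
        using norm_triangle_ineq4[of \<beta> "deriv B 0 * \<beta>'"] small by (simp add: \<beta>)
      then have "(norm (a 0))\<^sup>2 \<le> (norm \<beta> + norm \<beta>')\<^sup>2" by (intro power_mono) auto
      also have "\<dots> \<le> 2 * (norm \<beta>)\<^sup>2 + 2 * (norm \<beta>')\<^sup>2"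
        using sum_squares_bound[of "norm \<beta>" "norm \<beta>'"] by (simp add: power2_sum)
      finally have "pi * (norm (a 0))\<^sup>2 \<le> pi * (2 * (norm \<beta>)\<^sup>2 + 2 * (norm \<beta>')\<^sup>2)"
        by (intro mult_left_mono) auto
      then show "pi * (norm (a 0))\<^sup>2 \<le> 2 * (pi * (norm \<beta>)\<^sup>2) + 2 * (pi * (norm \<beta>')\<^sup>2)"
        by (simp only: distrib_left mult.left_commute)
    qed simp
    then have "3/4 * pi * (norm \<beta>)\<^sup>2 + pi / 8 * ((norm (a 0))\<^sup>2 + N * T) \<le> d"
      by (simp add: algebra_simps add_divide_distrib)
    then show ?thesis unfolding real sum \<beta>_def[symmetric] by (rule ennreal_leI)
  qed simp
qed

text \<open>Finite support lets the induction start from the zero series; Fatou's lemma later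
  removes the restriction. The added multiple of the squared linear coefficient pays for the one
  produced at the next step.\<close>

lemma dirichlet_iterate_series_upper_finite:
  assumes "bounded (range a)" "\<And>n. n \<ge> M \<Longrightarrow> a n = 0"
  shows "dirichlet_integral (iterate_series a) + ennreal (3 * pi * (norm (deriv (iterate_series a) 0))\<^sup>2)
     \<le> ennreal (12 * pi * (\<Sum>j<M. (norm (a j))\<^sup>2 * real N ^ j))"
  using assms
proof (induction M arbitrary: a)
  case 0
  then have "iterate_series a = (\<lambda>_. 0)" by (simp add: iterate_series_def fun_eq_iff)
  then show ?case by (simp add: dirichlet_integral_def)
next
  case (Suc M)
  define a' where "a' = (\<lambda>n. a (Suc n))"
  define \<beta> \<beta>' where "\<beta> = deriv (iterate_series a) 0" and "\<beta>' = deriv (iterate_series a') 0"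
  define T where "T = (\<Sum>j<M. (norm (a' j))\<^sup>2 * real N ^ j)"
  have a': "bounded (range a')" unfolding a'_def by (rule bounded_range_Suc[OF Suc.prems(1)])
  have a'0: "a' n = 0" if "n \<ge> M" for n unfolding a'_def using Suc.prems(2) that by simp
  have step: "dirichlet_integral (iterate_series a) + ennreal (pi * (norm (deriv B 0 * \<beta>'))\<^sup>2)
      = ennreal (pi * (norm \<beta>)\<^sup>2) + ennreal N * dirichlet_integral (iterate_series a')"
    unfolding \<beta>_def \<beta>'_def a'_def by (rule dirichlet_iterate_series_step[OF Suc.prems(1)])
  have \<beta>: "\<beta> = a 0 + deriv B 0 * \<beta>'"
    unfolding \<beta>_def \<beta>'_def a'_def by (rule deriv_iterate_series_shift[OF Suc.prems(1)])
  have sum: "(\<Sum>j<Suc M. (norm (a j))\<^sup>2 * real N ^ j) = (norm (a 0))\<^sup>2 + N * T"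
    unfolding sum.lessThan_Suc_shift T_def a'_def by (simp add: sum_distrib_left mult_ac)
  have small: "norm (deriv B 0 * \<beta>') \<le> norm \<beta>'"
    using norm_deriv_B_0 by (simp add: norm_mult mult_left_le_one_le)
  have "norm \<beta> \<le> norm (a 0) + norm \<beta>'"
    using norm_triangle_ineq[of "a 0" "deriv B 0 * \<beta>'"] small by (simp add: \<beta>)
  then have "(norm \<beta>)\<^sup>2 \<le> (norm (a 0) + norm \<beta>')\<^sup>2" by (intro power_mono) auto
  \<comment> \<open>Weighted Young inequality: the difference of the two sides is half of
    \<open>(2 * norm (a 0) - norm \<beta>')^2\<close>. Multiplication by \<open>1 + 3 = 4\<close>
    yields the constant 12 and the weight \<open>6 = 2 * 3\<close>, which \<open>N * 3\<close>
    dominates.\<close>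
  also have "\<dots> \<le> 3 * (norm (a 0))\<^sup>2 + 3/2 * (norm \<beta>')\<^sup>2"
    using zero_le_power2[of "2 * norm (a 0) - norm \<beta>'"]
    by (simp add: power2_eq_square algebra_simps)
  finally have "pi * (norm \<beta>)\<^sup>2 \<le> pi * (3 * (norm (a 0))\<^sup>2 + 3/2 * (norm \<beta>')\<^sup>2)"
    by (intro mult_left_mono) auto
  then have "pi * (norm \<beta>)\<^sup>2 \<le> 3 * (pi * (norm (a 0))\<^sup>2) + 3/2 * (pi * (norm \<beta>')\<^sup>2)"
    by (simp only: distrib_left mult.left_commute)
  moreover have "2 * (3 * (pi * (norm \<beta>')\<^sup>2)) \<le> N * (3 * (pi * (norm \<beta>')\<^sup>2))"
    using N_ge_2 by (intro mult_right_mono) auto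
  ultimately have real: "pi * (norm \<beta>)\<^sup>2 + 3 * pi * (norm \<beta>)\<^sup>2 \<le> 12 * pi * (norm (a 0))\<^sup>2 + N * (3 * pi * (norm \<beta>')\<^sup>2)"
    unfolding mult.assoc by linarith
  have "dirichlet_integral (iterate_series a) \<le> ennreal (pi * (norm \<beta>)\<^sup>2) + ennreal N * dirichlet_integral (iterate_series a')"
    unfolding step[symmetric] by simp
  then have "dirichlet_integral (iterate_series a) + ennreal (3 * pi * (norm \<beta>)\<^sup>2)
      \<le> ennreal (pi * (norm \<beta>)\<^sup>2 + 3 * pi * (norm \<beta>)\<^sup>2) + ennreal N * dirichlet_integral (iterate_series a')"
    by (subst ennreal_plus) (auto simp: ac_simps intro: add_left_mono)
  also have "\<dots> \<le> ennreal (12 * pi * (norm (a 0))\<^sup>2 + N * (3 * pi * (norm \<beta>')\<^sup>2)) + ennreal N * dirichlet_integral (iterate_series a')"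
    by (intro add_right_mono ennreal_leI real)
  also have "\<dots> = ennreal (12 * pi * (norm (a 0))\<^sup>2) + ennreal N * (dirichlet_integral (iterate_series a') + ennreal (3 * pi * (norm \<beta>')\<^sup>2))"
    by (simp add: distrib_left ennreal_mult ac_simps)
  also have "\<dots> \<le> ennreal (12 * pi * (norm (a 0))\<^sup>2) + ennreal N * ennreal (12 * pi * T)"
    using Suc.IH[OF a' a'0] unfolding \<beta>'_def T_def by (intro add_left_mono mult_left_mono) auto
  also have "\<dots> = ennreal (12 * pi * (\<Sum>j<Suc M. (norm (a j))\<^sup>2 * real N ^ j))"
  proof -
    have "0 \<le> T" by (simp add: T_def sum_nonneg)
    then show ?thesis unfolding sum by (simp add: distrib_left mult_ac flip: ennreal_mult ennreal_plus)
  qed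
  finally show ?case unfolding \<beta>_def .
qed

text \<open>The weight \<open>k = q / (1 - q)\<close> solves \<open>(1 + k) * q = k\<close>: the
  linear coefficient generated at one step is exactly absorbed at the next. Since
  \<open>1 + k = 1 / (1 - q)\<close>, each \<open>a j\<close> acquires the factor
  \<open>1 / (1 - q)^2\<close>.\<close>

lemma hardy_iterate_series_upper_finite:
  fixes a :: "nat \<Rightarrow> complex"
  defines "q \<equiv> norm (deriv B 0)"
  assumes "bounded (range a)" "\<And>n. n \<ge> M \<Longrightarrow> a n = 0"
  shows "hardy2_norm_sq (iterate_series a) + ennreal (q / (1 - q) * (norm (deriv (iterate_series a) 0))\<^sup>2)
     \<le> ennreal ((\<Sum>j<M. (norm (a j))\<^sup>2) / (1 - q)\<^sup>2)"
  using assms(2,3)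
proof (induction M arbitrary: a)
  case 0
  then have "iterate_series a = (\<lambda>_. 0)" by (simp add: iterate_series_def fun_eq_iff)
  then show ?case by (simp add: hardy2_norm_sq_def)
next
  case (Suc M)
  have q: "0 \<le> q" "q < 1" unfolding q_def using norm_deriv_B_0 by auto
  define a' where "a' = (\<lambda>n. a (Suc n))"
  define \<beta> \<beta>' where "\<beta> = deriv (iterate_series a) 0" and "\<beta>' = deriv (iterate_series a') 0"
  define T where "T = (\<Sum>j<M. (norm (a' j))\<^sup>2)"
  have a': "bounded (range a')" unfolding a'_def by (rule bounded_range_Suc[OF Suc.prems(1)])
  have a'0: "a' n = 0" if "n \<ge> M" for n unfolding a'_def using Suc.prems(2) that by simp
  have step: "hardy2_norm_sq (iterate_series a) \<le> ennreal ((norm \<beta>)\<^sup>2) + hardy2_norm_sq (iterate_series a')"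
    unfolding \<beta>_def a'_def by (rule hardy_iterate_series_step[OF Suc.prems(1)])
  have \<beta>: "\<beta> = a 0 + deriv B 0 * \<beta>'"
    unfolding \<beta>_def \<beta>'_def a'_def by (rule deriv_iterate_series_shift[OF Suc.prems(1)])
  have sum: "(\<Sum>j<Suc M. (norm (a j))\<^sup>2) = (norm (a 0))\<^sup>2 + T"
    unfolding sum.lessThan_Suc_shift T_def a'_def by simp
  have "norm \<beta> \<le> norm (a 0) + q * norm \<beta>'"
    using norm_triangle_ineq[of "a 0" "deriv B 0 * \<beta>'"] by (simp add: \<beta> q_def norm_mult)
  then have "(norm \<beta>)\<^sup>2 \<le> (norm (a 0) + q * norm \<beta>')\<^sup>2" by (intro power_mono) auto
  \<comment> \<open>Convexity of the square, with weights \<open>1 - q\<close> and \<open>q\<close>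
    at the points \<open>norm (a 0) / (1 - q)\<close> and \<open>norm \<beta>'\<close>.\<close>
  also have "\<dots> \<le> (norm (a 0))\<^sup>2 / (1 - q) + q * (norm \<beta>')\<^sup>2"
  proof -
    have "(norm (a 0))\<^sup>2 / (1 - q) + q * (norm \<beta>')\<^sup>2 - (norm (a 0) + q * norm \<beta>')\<^sup>2
        = q / (1 - q) * (norm (a 0) - (1 - q) * norm \<beta>')\<^sup>2"
      using q by (simp add: field_simps power2_eq_square)
    moreover have "0 \<le> q / (1 - q) * (norm (a 0) - (1 - q) * norm \<beta>')\<^sup>2" using q by simp
    ultimately show ?thesis by linarith
  qed
  finally have "(norm \<beta>)\<^sup>2 / (1 - q) \<le> ((norm (a 0))\<^sup>2 / (1 - q) + q * (norm \<beta>')\<^sup>2) / (1 - q)"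
    using q by (intro divide_right_mono) auto
  moreover have "(norm \<beta>)\<^sup>2 + q / (1 - q) * (norm \<beta>)\<^sup>2 = (norm \<beta>)\<^sup>2 / (1 - q)"
    using q by (simp add: field_simps)
  ultimately have real: "(norm \<beta>)\<^sup>2 + q / (1 - q) * (norm \<beta>)\<^sup>2 \<le> (norm (a 0))\<^sup>2 / (1 - q)\<^sup>2 + q / (1 - q) * (norm \<beta>')\<^sup>2"
    by (simp add: add_divide_distrib power2_eq_square)
  have "hardy2_norm_sq (iterate_series a) + ennreal (q / (1 - q) * (norm \<beta>)\<^sup>2)
      \<le> ennreal ((norm \<beta>)\<^sup>2) + hardy2_norm_sq (iterate_series a') + ennreal (q / (1 - q) * (norm \<beta>)\<^sup>2)"
    by (intro add_right_mono step)
  also have "\<dots> = ennreal ((norm \<beta>)\<^sup>2 + q / (1 - q) * (norm \<beta>)\<^sup>2) + hardy2_norm_sq (iterate_series a')"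
    using q by (subst ennreal_plus) (auto simp: ac_simps)
  also have "\<dots> \<le> ennreal ((norm (a 0))\<^sup>2 / (1 - q)\<^sup>2 + q / (1 - q) * (norm \<beta>')\<^sup>2) + hardy2_norm_sq (iterate_series a')"
    by (intro add_right_mono ennreal_leI real)
  also have "\<dots> = ennreal ((norm (a 0))\<^sup>2 / (1 - q)\<^sup>2) + (hardy2_norm_sq (iterate_series a') + ennreal (q / (1 - q) * (norm \<beta>')\<^sup>2))"
    using q by (subst ennreal_plus) (auto simp: ac_simps)
  also have "\<dots> \<le> ennreal ((norm (a 0))\<^sup>2 / (1 - q)\<^sup>2) + ennreal (T / (1 - q)\<^sup>2)"
    using Suc.IH[OF a' a'0] unfolding \<beta>'_def T_def by (intro add_left_mono)
  also have "\<dots> = ennreal ((\<Sum>j<Suc M. (norm (a j))\<^sup>2) / (1 - q)\<^sup>2)"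
  proof -
    have "0 \<le> T" by (simp add: T_def sum_nonneg)
    then show ?thesis unfolding sum by (simp add: add_divide_distrib flip: ennreal_plus)
  qed
  finally show ?case unfolding \<beta>_def .
qed

lemma iterate_series_truncate: "iterate_series (\<lambda>n. if n < M then a n else 0) = (\<lambda>z. \<Sum>n<M. a n * (B ^^ n) z)"
proof
  fix z
  have "iterate_series (\<lambda>n. if n < M then a n else 0) z = (\<Sum>n<M. (if n < M then a n else 0) * (B ^^ n) z)"
    unfolding iterate_series_def by (rule suminf_finite) auto
  then show "iterate_series (\<lambda>n. if n < M then a n else 0) z = (\<Sum>n<M. a n * (B ^^ n) z)" by simp
qed

lemma dirichlet_iterate_series_upper:
  assumes a: "bounded (range a)"
  shows "dirichlet_integral (iterate_series a) \<le> ennreal (12 * pi) * (\<Sum>n. ennreal ((norm (a n))\<^sup>2 * real N ^ n))"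
proof (rule dirichlet_integral_le_of_tendsto[OF holomorphic_partial deriv_partial_tendsto[OF a]])
  fix M
  have b: "bounded (range (\<lambda>n. if n < M then a n else 0))"
    by (rule bounded_subset[of "insert 0 (range a)"]) (use a in auto)
  have "dirichlet_integral (\<lambda>z. \<Sum>n<M. a n * (B ^^ n) z) = dirichlet_integral (iterate_series (\<lambda>n. if n < M then a n else 0))"
    unfolding iterate_series_truncate ..
  also have "\<dots> \<le> ennreal (12 * pi * (\<Sum>j<M. (norm (if j < M then a j else 0))\<^sup>2 * real N ^ j))"
    by (rule order_trans[OF _ dirichlet_iterate_series_upper_finite[OF b]]) auto
  also have "\<dots> = ennreal (12 * pi) * (\<Sum>j<M. ennreal ((norm (a j))\<^sup>2 * real N ^ j))"
    by (subst sum_ennreal) (auto simp: sum_nonneg ennreal_mult)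
  also have "\<dots> \<le> ennreal (12 * pi) * (\<Sum>n. ennreal ((norm (a n))\<^sup>2 * real N ^ n))"
    by (intro mult_left_mono sum_le_suminf) (auto intro: summableI)
  finally show "dirichlet_integral (\<lambda>z. \<Sum>n<M. a n * (B ^^ n) z)
      \<le> ennreal (12 * pi) * (\<Sum>n. ennreal ((norm (a n))\<^sup>2 * real N ^ n))" .
qed

lemma hardy_iterate_series_upper:
  assumes a: "bounded (range a)"
  shows "hardy2_norm_sq (iterate_series a) \<le> ennreal (1 / (1 - norm (deriv B 0))\<^sup>2) * (\<Sum>n. ennreal ((norm (a n))\<^sup>2))"
proof (rule hardy2_norm_sq_le_of_tendsto[OF holomorphic_partial iterate_series_sums[OF a, unfolded sums_def]])
  fix M
  let ?C = "1 / (1 - norm (deriv B 0))\<^sup>2"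
  have b: "bounded (range (\<lambda>n. if n < M then a n else 0))"
    by (rule bounded_subset[of "insert 0 (range a)"]) (use a in auto)
  have "hardy2_norm_sq (\<lambda>z. \<Sum>n<M. a n * (B ^^ n) z) = hardy2_norm_sq (iterate_series (\<lambda>n. if n < M then a n else 0))"
    unfolding iterate_series_truncate ..
  also have "\<dots> \<le> ennreal ((\<Sum>j<M. (norm (if j < M then a j else 0))\<^sup>2) / (1 - norm (deriv B 0))\<^sup>2)"
    by (rule order_trans[OF _ hardy_iterate_series_upper_finite[OF b]]) auto
  also have "\<dots> = ennreal ?C * (\<Sum>j<M. ennreal ((norm (a j))\<^sup>2))"
    by (subst sum_ennreal) (auto simp: sum_nonneg simp flip: ennreal_mult)
  also have "\<dots> \<le> ennreal ?C * (\<Sum>n. ennreal ((norm (a n))\<^sup>2))"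
    by (intro mult_left_mono sum_le_suminf) (auto intro: summableI)
  finally show "hardy2_norm_sq (\<lambda>z. \<Sum>n<M. a n * (B ^^ n) z) \<le> ennreal ?C * (\<Sum>n. ennreal ((norm (a n))\<^sup>2))" .
qed

end

section \<open>From the two-sided bounds to the series in the given \<open>f\<close>\<close>

lemma dirichlet_space_iff_summable:
  assumes "g holomorphic_on ball 0 1" "\<And>n. 0 \<le> x n" "0 < C"
    and "ennreal (inverse C) * (\<Sum>n. ennreal (x n)) \<le> dirichlet_integral g"
    and "dirichlet_integral g \<le> ennreal C * (\<Sum>n. ennreal (x n))"
  shows "g \<in> dirichlet_space \<longleftrightarrow> summable x"
proof
  assume "g \<in> dirichlet_space"
  then have "dirichlet_integral g < top" by (simp add: dirichlet_space_def)
  with assms(4) have "ennreal (inverse C) * (\<Sum>n. ennreal (x n)) < top" by (rule le_less_trans)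
  then have "(\<Sum>n. ennreal (x n)) \<noteq> top"
    using assms(3) by (auto simp: ennreal_mult_top)
  then show "summable x" using assms(2) by (intro summable_suminf_not_top)
next
  assume "summable x"
  then have "(\<Sum>n. ennreal (x n)) = ennreal (suminf x)" using assms(2) by (intro suminf_ennreal2)
  with assms(5) have "dirichlet_integral g \<le> ennreal C * ennreal (suminf x)" by simp
  also have "\<dots> < top" by (simp add: ennreal_mult_less_top)
  finally show "g \<in> dirichlet_space" using assms(1) by (simp add: dirichlet_space_def)
qed

theorem theorem4p2:
  fixes f :: "complex \<Rightarrow> complex" and N :: nat
  assumes "finite_blaschke_product N f" and "N > 1" and "f 0 = 0"
  shows "\<exists>C::real. C > 0 \<and>
    (\<forall>a :: nat \<Rightarrow> complex. summable (\<lambda>n. (norm (a (Suc n)))\<^sup>2) \<longrightarrow>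
      (let F = (\<lambda>z. \<Sum>n. a (Suc n) * (f ^^ Suc n) z) in
         hardy2_sums (\<lambda>n z. a (Suc n) * (f ^^ Suc n) z) F \<and>
         (F \<in> dirichlet_space \<longleftrightarrow> summable (\<lambda>n. (norm (a (Suc n)))\<^sup>2 * real N ^ Suc n)) \<and>
         ennreal (inverse C) * (\<Sum>n. ennreal ((norm (a (Suc n)))\<^sup>2 * real N ^ Suc n))
           \<le> dirichlet_integral F \<and>
         dirichlet_integral F
           \<le> ennreal C * (\<Sum>n. ennreal ((norm (a (Suc n)))\<^sup>2 * real N ^ Suc n))))"
proof -
  obtain c \<alpha> where c: "norm c = 1" and \<alpha>: "\<And>k. k < N \<Longrightarrow> norm (\<alpha> k) < 1"
    and f: "\<And>z. z \<in> ball 0 1 \<Longrightarrow> f z = c * (\<Prod>k<N. (z - \<alpha> k) / (1 - cnj (\<alpha> k) * z))"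
    using assms(1) unfolding finite_blaschke_product_def by blast
  interpret blaschke N c \<alpha>
    by unfold_locales (use assms(2) c \<alpha> in auto)
  have fB: "f z = B z" if "z \<in> ball 0 1" for z using f[OF that] by (simp add: B_def)
  interpret blaschke_origin N c \<alpha>
    by unfold_locales (use assms(2,3) fB[of 0] in auto)
  \<comment> \<open>\<open>f\<close> and \<open>B\<close> are identified only in the disc;
    invariance of the disc under \<open>B\<close> extends this to the iterates.\<close>
  have iter: "(f ^^ n) z = (B ^^ n) z" if z: "z \<in> ball 0 1" for n z
  proof (induction n)
    case (Suc n)
    then show ?case using fB[OF iterate_disc[OF z]] by simp
  qed simp
  define H where "H = ennreal (1 / (1 - norm (deriv B 0))\<^sup>2)"
  have H: "H < top" by (simp add: H_def)
  show ?thesis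
  \<comment> \<open>The upper estimate dictates \<open>12 * pi\<close>. The lower constant
    \<open>pi / 8\<close> exceeds its inverse, so one number serves for both bounds.\<close>
  proof (intro exI[of _ "12 * pi"] conjI allI impI)
    show "0 < 12 * pi" by simp
    fix a :: "nat \<Rightarrow> complex"
    assume a2: "summable (\<lambda>n. (norm (a (Suc n)))\<^sup>2)"
    define F where "F = (\<lambda>z. \<Sum>n. a (Suc n) * (f ^^ Suc n) z)"
    define x where "x n = (norm (a (Suc n)))\<^sup>2 * real N ^ Suc n" for n
    \<comment> \<open>Coefficient 0 at index 0 removes the identity term of
      \<open>iterate_series\<close>; square summability makes the remaining coefficients
      bounded.\<close>
    define A where "A n = (if n = 0 then 0 else a n)" for n
    have bounded_A: "bounded (range A)"
    proof -
      have "(\<lambda>n. (norm (a (Suc n)))\<^sup>2) \<longlonglongrightarrow> 0" using a2 by (rule summable_LIMSEQ_zero)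
      then have "(\<lambda>n. sqrt ((norm (a (Suc n)))\<^sup>2)) \<longlonglongrightarrow> sqrt 0" by (rule tendsto_real_sqrt)
      then have "(\<lambda>n. a (Suc n)) \<longlonglongrightarrow> 0" by (simp add: tendsto_norm_zero_iff)
      then have "bounded (range (\<lambda>n. a (Suc n)))" by (intro convergent_imp_bounded)
      then have "bounded (insert 0 (range (\<lambda>n. a (Suc n))))" by simp
      moreover have "A n \<in> insert 0 (range (\<lambda>n. a (Suc n)))" for n
        by (cases n) (auto simp: A_def)
      then have "range A \<subseteq> insert 0 (range (\<lambda>n. a (Suc n)))" by blast
      ultimately show ?thesis by (rule bounded_subset)
    qed
    have shift: "(\<Sum>n. ennreal (g (norm (A n)) n)) = (\<Sum>n. ennreal (g (norm (a (Suc n))) (Suc n)))"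
      if "g 0 0 = 0" for g :: "real \<Rightarrow> nat \<Rightarrow> real"
      by (subst suminf_offset[of _ 1]) (auto simp: A_def that intro: summableI)
    have F: "F z = iterate_series A z" if z: "z \<in> ball 0 1" for z
    proof -
      have "iterate_series A z = (\<Sum>n. A (Suc n) * (B ^^ Suc n) z) + A 0 * (B ^^ 0) z"
        unfolding iterate_series_def by (subst suminf_split_head) (use iterate_series_sums[OF bounded_A z] in \<open>auto simp: sums_iff\<close>)
      then show ?thesis unfolding F_def by (simp only: iter[OF z]) (simp add: A_def)
    qed
    have holF: "F holomorphic_on ball 0 1"
      using holomorphic_iterate_series[OF bounded_A] by (rule holomorphic_transform) (simp add: F)
    have DF: "dirichlet_integral F = dirichlet_integral (iterate_series A)" by (rule dirichlet_integral_cong[OF F])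
    have sum_A: "(\<Sum>n. ennreal ((norm (A n))\<^sup>2 * real N ^ n)) = (\<Sum>n. ennreal (x n))"
      unfolding x_def by (rule shift) simp
    have upper: "dirichlet_integral F \<le> ennreal (12 * pi) * (\<Sum>n. ennreal (x n))"
      unfolding DF sum_A[symmetric] by (rule dirichlet_iterate_series_upper[OF bounded_A])
    have lower: "ennreal (inverse (12 * pi)) * (\<Sum>n. ennreal (x n)) \<le> dirichlet_integral F"
      unfolding DF sum_A[symmetric] ennreal_suminf_cmult[symmetric]
    proof (rule suminf_le_const)
      fix M
      let ?T = "\<Sum>n<M. (norm (A n))\<^sup>2 * real N ^ n"
      have pi: "inverse (12 * pi) \<le> pi / 8"
      proof -
        have "8 \<le> 12 * (pi * pi)" using mult_mono[of 3 pi 3 pi] pi_gt3 by simp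
        then show ?thesis by (simp add: field_simps)
      qed
      have "(\<Sum>n<M. ennreal (inverse (12 * pi)) * ennreal ((norm (A n))\<^sup>2 * real N ^ n)) = ennreal (inverse (12 * pi) * ?T)"
        unfolding sum_distrib_left[symmetric] by (subst sum_ennreal) (simp_all add: sum_nonneg flip: ennreal_mult)
      also have "\<dots> \<le> ennreal (3/4 * pi * (norm (deriv (iterate_series A) 0))\<^sup>2 + pi / 8 * ?T)"
        by (intro ennreal_leI add_increasing mult_right_mono[OF pi]) (simp_all add: sum_nonneg)
      also have "\<dots> \<le> dirichlet_integral (iterate_series A)" by (rule dirichlet_iterate_series_lower[OF bounded_A])
      finally show "(\<Sum>n<M. ennreal (inverse (12 * pi)) * ennreal ((norm (A n))\<^sup>2 * real N ^ n)) \<le> dirichlet_integral (iterate_series A)" .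
    qed (rule summableI)
    have D_iff: "F \<in> dirichlet_space \<longleftrightarrow> summable x"
      by (rule dirichlet_space_iff_summable[OF holF _ _ lower upper]) (simp_all add: x_def)
    have in_hardy: "g \<in> hardy2" if hol: "g holomorphic_on ball 0 1" and le: "hardy2_norm_sq g \<le> H * ennreal t" for g t
    proof -
      have "H * ennreal t < top" using H by (simp add: ennreal_mult_less_top)
      with le have "hardy2_norm_sq g < top" by (rule le_less_trans)
      then show ?thesis using hol by (simp add: hardy2_def)
    qed
    define t where "t m = (\<Sum>n. (norm (a (Suc (n + m))))\<^sup>2)" for m
    have tail: "hardy2_norm_sq (\<lambda>z. F z - (\<Sum>n<m. a (Suc n) * (f ^^ Suc n) z)) \<le> H * ennreal (t m)" for m
    proof -
      \<comment> \<open>The remainder after \<open>m\<close> terms is again an iterate series, with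
        indices \<open>0\<close> to \<open>m\<close> erased: the dummy index and the
        \<open>m\<close> summed ones. The Hardy bound then gives the tail of the square sum.\<close>
      define A' where "A' n = (if n \<le> m then 0 else A n)" for n
      have bounded_A': "bounded (range A')"
        by (rule bounded_subset[of "insert 0 (range A)"]) (use bounded_A in \<open>auto simp: A'_def\<close>)
      have "hardy2_norm_sq (\<lambda>z. F z - (\<Sum>n<m. a (Suc n) * (f ^^ Suc n) z)) = hardy2_norm_sq (iterate_series A')"
      proof (rule hardy2_norm_sq_cong)
        fix z :: complex assume z: "z \<in> ball 0 1"
        have "(\<lambda>n. A n * (B ^^ n) z - (if n < Suc m then A n * (B ^^ n) z else 0)) sums (iterate_series A z - (\<Sum>n<Suc m. A n * (B ^^ n) z))"
          using sums_If_finite[of "\<lambda>n. n < Suc m" "\<lambda>n. A n * (B ^^ n) z"] iterate_series_sums[OF bounded_A z]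
          by (intro sums_diff) (simp_all add: lessThan_def)
        moreover have "(\<lambda>n. A n * (B ^^ n) z - (if n < Suc m then A n * (B ^^ n) z else 0)) = (\<lambda>n. A' n * (B ^^ n) z)"
          by (auto simp: A'_def less_Suc_eq_le)
        ultimately have "iterate_series A' z = iterate_series A z - (\<Sum>n<Suc m. A n * (B ^^ n) z)"
          using iterate_series_sums[OF bounded_A' z] sums_unique2 by metis
        also have "(\<Sum>n<Suc m. A n * (B ^^ n) z) = (\<Sum>n<m. a (Suc n) * (f ^^ Suc n) z)"
          unfolding sum.lessThan_Suc_shift iter[OF z] by (simp add: A_def)
        finally show "F z - (\<Sum>n<m. a (Suc n) * (f ^^ Suc n) z) = iterate_series A' z" by (simp only: F[OF z])
      qed
      also have "\<dots> \<le> H * (\<Sum>n. ennreal ((norm (A' n))\<^sup>2))"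
        unfolding H_def by (rule hardy_iterate_series_upper[OF bounded_A'])
      also have "(\<Sum>n. ennreal ((norm (A' n))\<^sup>2)) = (\<Sum>n. ennreal ((norm (a (Suc (n + m))))\<^sup>2))"
        by (subst suminf_offset[of _ "Suc m"]) (auto simp: A'_def A_def intro: summableI)
      also have "\<dots> = ennreal (t m)"
        unfolding t_def by (rule suminf_ennreal2) (use summable_ignore_initial_segment[OF a2, of m] in auto)
      finally show ?thesis .
    qed
    have sums: "hardy2_sums (\<lambda>n z. a (Suc n) * (f ^^ Suc n) z) F"
      unfolding hardy2_sums_def
    proof (intro conjI allI)
      show "F \<in> hardy2" using tail[of 0] by (intro in_hardy[OF holF]) simp
      fix n
      have hol_n: "(\<lambda>z. a (Suc n) * (f ^^ Suc n) z) holomorphic_on ball 0 1"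
        by (rule holomorphic_transform[OF holomorphic_on_mult[OF holomorphic_on_const holomorphic_iterate[of "Suc n"]]])
          (simp only: iter)
      \<comment> \<open>A single term is an iterate series with one nonzero coefficient, so the same
        Hardy bound gives its membership.\<close>
      define A' where "A' k = (if k = Suc n then a (Suc n) else 0)" for k
      have bounded_A': "bounded (range A')"
        by (rule bounded_subset[of "{0, a (Suc n)}"]) (auto simp: A'_def)
      have "hardy2_norm_sq (\<lambda>z. a (Suc n) * (f ^^ Suc n) z) = hardy2_norm_sq (iterate_series A')"
      proof (rule hardy2_norm_sq_cong)
        fix z :: complex assume z: "z \<in> ball 0 1"
        have "iterate_series A' z = (\<Sum>k\<in>{Suc n}. A' k * (B ^^ k) z)"
          unfolding iterate_series_def by (rule suminf_finite) (auto simp: A'_def)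
        then show "a (Suc n) * (f ^^ Suc n) z = iterate_series A' z" unfolding iter[OF z] by (simp add: A'_def)
      qed
      also have "\<dots> \<le> H * (\<Sum>k. ennreal ((norm (A' k))\<^sup>2))"
        unfolding H_def by (rule hardy_iterate_series_upper[OF bounded_A'])
      also have "(\<Sum>k. ennreal ((norm (A' k))\<^sup>2)) = (\<Sum>k\<in>{Suc n}. ennreal ((norm (A' k))\<^sup>2))"
        by (rule suminf_finite) (auto simp: A'_def)
      also have "\<dots> = ennreal ((norm (a (Suc n)))\<^sup>2)" by (simp add: A'_def)
      finally show "(\<lambda>z. a (Suc n) * (f ^^ Suc n) z) \<in> hardy2" by (rule in_hardy[OF hol_n])
    next
      have "t = (\<lambda>m. suminf (\<lambda>n. (norm (a (Suc n)))\<^sup>2) - (\<Sum>n<m. (norm (a (Suc n)))\<^sup>2))"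
        unfolding t_def using suminf_minus_initial_segment[OF a2] by simp
      moreover have "(\<lambda>m. suminf (\<lambda>n. (norm (a (Suc n)))\<^sup>2) - (\<Sum>n<m. (norm (a (Suc n)))\<^sup>2)) \<longlonglongrightarrow>
          suminf (\<lambda>n. (norm (a (Suc n)))\<^sup>2) - suminf (\<lambda>n. (norm (a (Suc n)))\<^sup>2)"
        by (intro tendsto_intros summable_LIMSEQ a2)
      ultimately have "t \<longlonglongrightarrow> 0" by simp
      then have "(\<lambda>m. H * ennreal (t m)) \<longlonglongrightarrow> H * ennreal 0"
        using H by (intro ennreal_tendsto_cmult tendsto_ennrealI)
      then have lim: "(\<lambda>m. H * ennreal (t m)) \<longlonglongrightarrow> 0" by simp
      show "(\<lambda>m. hardy2_norm_sq (\<lambda>z. F z - (\<Sum>n<m. a (Suc n) * (f ^^ Suc n) z))) \<longlonglongrightarrow> 0"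
        by (rule tendsto_sandwich[OF _ always_eventually[OF allI[OF tail]] tendsto_const lim]) simp
    qed
    show "let F = (\<lambda>z. \<Sum>n. a (Suc n) * (f ^^ Suc n) z) in
         hardy2_sums (\<lambda>n z. a (Suc n) * (f ^^ Suc n) z) F \<and>
         (F \<in> dirichlet_space \<longleftrightarrow> summable (\<lambda>n. (norm (a (Suc n)))\<^sup>2 * real N ^ Suc n)) \<and>
         ennreal (inverse (12 * pi)) * (\<Sum>n. ennreal ((norm (a (Suc n)))\<^sup>2 * real N ^ Suc n))
           \<le> dirichlet_integral F \<and>
         dirichlet_integral F
           \<le> ennreal (12 * pi) * (\<Sum>n. ennreal ((norm (a (Suc n)))\<^sup>2 * real N ^ Suc n))"
      unfolding Let_def F_def[symmetric] using sums D_iff lower upper unfolding x_def by blast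
  qed
qed

end
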